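(* Let $R$ be an integral domain with field of fractions $K$ of characteristic zero, let $\overline{K}$ be an algebraic closure of $K$, let $G=Gal(\overline{K}/K)$, and let $\Sigma\subseteq\overline{K}^*_{\times}$ be a cyclotomic Bost-Connes datum. Then the Hopf algebra $\overline{K}[\Sigma]^G$ describing the abstract Bost-Connes system of $\Sigma$ is a sub-bialgebra of $\mathbb{L}(K)$; that is, there is an injective morphism of $K$-bialgebras $\overline{K}[\Sigma]^G\to\mathbb{L}(K)$.
   Context: $\overline{K}^*_{\times}$ is the multiplicative group of non-zero elements of $\overline{K}$ and $\boldsymbol{\mu}_\infty$ its subgroup of all roots of unity. A cyclotomic Bost-Connes datum is a divisible subgroup $\Sigma$ with $\boldsymbol{\mu}_\infty\subseteq\Sigma\subseteq\overline{K}^*_{\times}$, stable under the action of $G$. $\overline{K}[\Sigma]$ is the group algebra of $\Sigma$ over $\overline{K}$ with its usual Hopf algebra structure (elements of $\Sigma$ are group-like); $G$ acts both on the coefficients in $\overline{K}$ and on $\Sigma$, and $\overline{K}[\Sigma]^G$ is the $K$-Hopf algebra of $G$-invariants. For a field $K$, give $K[t]$ the coalgebra structure with $\Delta(t)=t\otimes t$ and $\epsilon(t)=1$, and identify the full linear dual $K[t]^*$ with the space of sequences $f=(f_n)_{n\geq0}$ via $f_n=f(t^n)$. $\mathbb{L}(K)=K[t]^o=\varinjlim\,(K[t]/(m(t)))^*$ (limit over monic polynomials $m(t)$ ordered by divisibility) is the space of all sequences vanishing on some ideal $(m(t))$ with $m$ monic, that is, of all linear recursive sequences over $K$. It is a bialgebra: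 multiplication is the Hadamard (componentwise) product $(f.g)_n=f_ng_n$ with unit $(1,1,1,\ldots)$, and the coalgebra structure is dual to the ring structures on the $K[t]/(m(t))$; in particular the counit is $\epsilon(f)=f_0$. *)

theory Defs
  imports "HOL-Algebra.Algebraic_Closure_Type" "HOL-Library.Poly_Mapping"
begin

text \<open>
  The fields \<open>K\<close> and \<open>\<^bold>K\<close> (an algebraic closure of \<open>K\<close>) are types \<open>'k\<close>, \<open>'c\<close> together with an
  embedding \<open>\<iota> :: 'k \<Rightarrow> 'c\<close>. Algebras, tensor products and bialgebras are HOL-Algebra records,
  whose scalars are the elements of a type \<open>'k :: field\<close>, i.e. of the ring
  \<^const>\<open>ring_of_type_algebra\<close>.
\<close>

section \<open>Fields of fractions and algebraic closures\<close>

definition fraction_field :: "('r::idom \<Rightarrow> 'k::field) \<Rightarrow> bool" where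
  "fraction_field \<rho> \<longleftrightarrow>
     \<rho> \<in> ring_hom ring_of_type_algebra ring_of_type_algebra \<and> inj \<rho> \<and>
     (\<forall>x. \<exists>a b. b \<noteq> 0 \<and> x = \<rho> a / \<rho> b)"

definition algebraic_closure_emb :: "('k::field \<Rightarrow> 'c::alg_closed_field) \<Rightarrow> bool" where
  "algebraic_closure_emb \<iota> \<longleftrightarrow>
     \<iota> \<in> ring_hom ring_of_type_algebra ring_of_type_algebra \<and>
     (\<forall>x. \<exists>p. p \<noteq> 0 \<and> poly (map_poly \<iota> p) x = 0)"

lemma fraction_field_Fract: "fraction_field (\<lambda>a::'r::idom. Fract a 1)"
  unfolding fraction_field_def
proof (intro conjI allI)
  show "(\<lambda>a::'r. Fract a 1) \<in> ring_hom ring_of_type_algebra ring_of_type_algebra"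
    by (rule ring_hom_memI) (auto simp: ring_of_type_algebra_def One_fract_def)
  show "inj (\<lambda>a::'r. Fract a 1)"
    by (auto simp: inj_def eq_fract)
  fix x :: "'r fract"
  show "\<exists>a b. b \<noteq> 0 \<and> x = Fract a 1 / Fract b 1"
    by (cases x) (auto intro!: exI)
qed

lemma algebraic_closure_emb_to_ac: "algebraic_closure_emb (to_ac :: 'k::field \<Rightarrow> _)"
  unfolding algebraic_closure_emb_def
proof (intro conjI allI)
  show "(to_ac :: 'k \<Rightarrow> _) \<in> ring_hom ring_of_type_algebra ring_of_type_algebra"
    by (rule ring_hom_memI) (auto simp: ring_of_type_algebra_def)
  fix x :: "'k alg_closure"
  show "\<exists>p. p \<noteq> 0 \<and> poly (map_poly to_ac p) x = 0"
    using alg_closure_algebraic[of x] by metis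
qed

definition galois_group :: "('k::field \<Rightarrow> 'c::field) \<Rightarrow> ('c \<Rightarrow> 'c) set" where
  "galois_group \<iota> =
     {\<sigma> \<in> ring_iso ring_of_type_algebra ring_of_type_algebra. \<forall>x. \<sigma> (\<iota> x) = \<iota> x}"

definition cyclotomic_bost_connes_datum :: "('k::field \<Rightarrow> 'c::field) \<Rightarrow> 'c set \<Rightarrow> bool" where
  "cyclotomic_bost_connes_datum \<iota> S \<longleftrightarrow>
     subgroup S (units_of ring_of_type_algebra) \<and>
     (\<forall>n>0. \<forall>x\<in>S. \<exists>y\<in>S. y ^ n = x) \<and>
     {z. \<exists>n>0. z ^ n = 1} \<subseteq> S \<and>
     (\<forall>\<sigma>\<in>galois_group \<iota>. \<sigma> ` S \<subseteq> S)"


section \<open>Tensor products\<close>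

definition lin_hom ::
    "('k, 'a, 'm) module_scheme \<Rightarrow> ('k, 'b, 'n) module_scheme \<Rightarrow> ('a \<Rightarrow> 'b) set" where
  "lin_hom M N = {h \<in> carrier M \<rightarrow> carrier N.
     (\<forall>x\<in>carrier M. \<forall>y\<in>carrier M. h (x \<oplus>\<^bsub>M\<^esub> y) = h x \<oplus>\<^bsub>N\<^esub> h y) \<and>
     (\<forall>c. \<forall>x\<in>carrier M. h (c \<odot>\<^bsub>M\<^esub> x) = c \<odot>\<^bsub>N\<^esub> h x)}"

definition algebra_hom ::
    "('k, 'a, 'm) module_scheme \<Rightarrow> ('k, 'b, 'n) module_scheme \<Rightarrow> ('a \<Rightarrow> 'b) set" where
  "algebra_hom M N = ring_hom M N \<inter> lin_hom M N"

text \<open>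
  \<open>M \<otimes> N\<close> is the quotient of the free vector space on \<open>carrier M \<times> carrier N\<close> (finitely supported
  functions) by the span of the bilinearity relators; its elements are cosets.
\<close>

definition tensor_relators ::
    "('k::field, 'a, 'm) module_scheme \<Rightarrow> ('k, 'b, 'n) module_scheme \<Rightarrow> ('a \<times> 'b \<Rightarrow>\<^sub>0 'k) set" where
  "tensor_relators M N =
     {Poly_Mapping.single (x \<oplus>\<^bsub>M\<^esub> x', y) 1 - Poly_Mapping.single (x, y) 1 - Poly_Mapping.single (x', y) 1
        | x x' y. x \<in> carrier M \<and> x' \<in> carrier M \<and> y \<in> carrier N} \<union>
     {Poly_Mapping.single (x, y \<oplus>\<^bsub>N\<^esub> y') 1 - Poly_Mapping.single (x, y) 1 - Poly_Mapping.single (x, y') 1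
        | x y y'. x \<in> carrier M \<and> y \<in> carrier N \<and> y' \<in> carrier N} \<union>
     {Poly_Mapping.single (c \<odot>\<^bsub>M\<^esub> x, y) 1 - Poly_Mapping.single (x, y) c
        | c x y. x \<in> carrier M \<and> y \<in> carrier N} \<union>
     {Poly_Mapping.single (x, c \<odot>\<^bsub>N\<^esub> y) 1 - Poly_Mapping.single (x, y) c
        | c x y. x \<in> carrier M \<and> y \<in> carrier N}"

abbreviation scale_pm :: "'k::field \<Rightarrow> ('a \<Rightarrow>\<^sub>0 'k) \<Rightarrow> ('a \<Rightarrow>\<^sub>0 'k)" where
  "scale_pm c \<equiv> Poly_Mapping.map ((*) c)"

definition tensor_class ::
    "('k::field, 'a, 'm) module_scheme \<Rightarrow> ('k, 'b, 'n) module_scheme \<Rightarrow>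
     ('a \<times> 'b \<Rightarrow>\<^sub>0 'k) \<Rightarrow> ('a \<times> 'b \<Rightarrow>\<^sub>0 'k) set" where
  "tensor_class M N x = (\<lambda>z. x + z) ` module.span scale_pm (tensor_relators M N)"

definition tensor_rep :: "('a \<times> 'b \<Rightarrow>\<^sub>0 'k::field) set \<Rightarrow> ('a \<times> 'b \<Rightarrow>\<^sub>0 'k)" where
  "tensor_rep U = (SOME x. x \<in> U)"

definition pure_tensor ::
    "('k::field, 'a, 'm) module_scheme \<Rightarrow> ('k, 'b, 'n) module_scheme \<Rightarrow>
     'a \<Rightarrow> 'b \<Rightarrow> ('a \<times> 'b \<Rightarrow>\<^sub>0 'k) set" where
  "pure_tensor M N x y = tensor_class M N (Poly_Mapping.single (x, y) 1)"

definition tensor_product ::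
    "('k::field, 'a, 'm) module_scheme \<Rightarrow> ('k, 'b, 'n) module_scheme \<Rightarrow>
     ('k, ('a \<times> 'b \<Rightarrow>\<^sub>0 'k) set) module" where
  "tensor_product M N =
     \<lparr>carrier = tensor_class M N ` {x. Poly_Mapping.keys x \<subseteq> carrier M \<times> carrier N},
      monoid.mult = (\<lambda>U V. tensor_class M N
        (\<Sum>p\<in>Poly_Mapping.keys (tensor_rep U). \<Sum>q\<in>Poly_Mapping.keys (tensor_rep V).
           Poly_Mapping.single (fst p \<otimes>\<^bsub>M\<^esub> fst q, snd p \<otimes>\<^bsub>N\<^esub> snd q)
             (Poly_Mapping.lookup (tensor_rep U) p * Poly_Mapping.lookup (tensor_rep V) q))),
      one = pure_tensor M N \<one>\<^bsub>M\<^esub> \<one>\<^bsub>N\<^esub>,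
      ring.zero = tensor_class M N 0,
      add = (\<lambda>U V. tensor_class M N (tensor_rep U + tensor_rep V)),
      module.smult = (\<lambda>c U. tensor_class M N (scale_pm c (tensor_rep U)))\<rparr>"

text \<open>
  The linear map \<open>M \<otimes> N \<rightarrow> P\<close> induced by \<open>\<beta> : M \<times> N \<rightarrow> P\<close>; independent of the chosen
  representative if \<open>\<beta>\<close> is bilinear.
\<close>

definition tensor_lift ::
    "('k::field, 'p, 'm) module_scheme \<Rightarrow> ('a \<Rightarrow> 'b \<Rightarrow> 'p) \<Rightarrow> ('a \<times> 'b \<Rightarrow>\<^sub>0 'k) set \<Rightarrow> 'p" where
  "tensor_lift P \<beta> U =
     (\<Oplus>\<^bsub>P\<^esub>p\<in>Poly_Mapping.keys (tensor_rep U).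
        Poly_Mapping.lookup (tensor_rep U) p \<odot>\<^bsub>P\<^esub> \<beta> (fst p) (snd p))"

definition tensor_map ::
    "('k::field, 'c, 'm) module_scheme \<Rightarrow> ('k, 'd, 'n) module_scheme \<Rightarrow>
     ('a \<Rightarrow> 'c) \<Rightarrow> ('b \<Rightarrow> 'd) \<Rightarrow> ('a \<times> 'b \<Rightarrow>\<^sub>0 'k) set \<Rightarrow> ('c \<times> 'd \<Rightarrow>\<^sub>0 'k) set" where
  "tensor_map M' N' f g = tensor_lift (tensor_product M' N') (\<lambda>x y. pure_tensor M' N' (f x) (g y))"

text \<open>The isomorphism \<open>(M \<otimes> N) \<otimes> P \<rightarrow> M \<otimes> (N \<otimes> P)\<close>.\<close>

definition tensor_assoc ::
    "('k::field, 'a, 'm) module_scheme \<Rightarrow> ('k, 'b, 'n) module_scheme \<Rightarrow> ('k, 'c, 'p) module_scheme \<Rightarrow>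
     (('a \<times> 'b \<Rightarrow>\<^sub>0 'k) set \<times> 'c \<Rightarrow>\<^sub>0 'k) set \<Rightarrow> ('a \<times> ('b \<times> 'c \<Rightarrow>\<^sub>0 'k) set \<Rightarrow>\<^sub>0 'k) set" where
  "tensor_assoc M N P =
     (let T = tensor_product M (tensor_product N P) in
      tensor_lift T (\<lambda>U z.
        tensor_lift T (\<lambda>x y. pure_tensor M (tensor_product N P) x (pure_tensor N P y z)) U))"


section \<open>Bialgebras\<close>

definition scalar_algebra :: "('k::field, 'k) module" where
  "scalar_algebra = ring.extend ring_of_type_algebra (module.fields (*))"

record (overloaded) ('k::zero, 'a) bialgebra = "('k, 'a) module" +
  comult :: "'a \<Rightarrow> ('a \<times> 'a \<Rightarrow>\<^sub>0 'k) set"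
  counit :: "'a \<Rightarrow> 'k"

text \<open>All bialgebras here are commutative, as \<^locale>\<open>algebra\<close> is.\<close>

locale bialgebra = algebra "ring_of_type_algebra :: 'k ring" A
  for A :: "('k::field, 'a, 'm) bialgebra_scheme" (structure) +
  assumes comult_hom: "comult A \<in> algebra_hom A (tensor_product A A)"
    and counit_hom: "counit A \<in> algebra_hom A scalar_algebra"
    and coassoc: "x \<in> carrier A \<Longrightarrow>
      tensor_assoc A A A (tensor_map (tensor_product A A) A (comult A) id (comult A x)) =
      tensor_map A (tensor_product A A) id (comult A) (comult A x)"
    and counit_left: "x \<in> carrier A \<Longrightarrow>
      tensor_lift A (\<lambda>a b. counit A a \<odot>\<^bsub>A\<^esub> b) (comult A x) = x"
    and counit_right: "x \<in> carrier A \<Longrightarrow>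
      tensor_lift A (\<lambda>a b. counit A b \<odot>\<^bsub>A\<^esub> a) (comult A x) = x"

locale hopf_algebra = bialgebra +
  assumes ex_antipode: "\<exists>S\<in>lin_hom A A. \<forall>x\<in>carrier A.
      tensor_lift A (\<lambda>a b. S a \<otimes>\<^bsub>A\<^esub> b) (comult A x) = counit A x \<odot>\<^bsub>A\<^esub> \<one>\<^bsub>A\<^esub> \<and>
      tensor_lift A (\<lambda>a b. a \<otimes>\<^bsub>A\<^esub> S b) (comult A x) = counit A x \<odot>\<^bsub>A\<^esub> \<one>\<^bsub>A\<^esub>"

locale bialgebra_hom = A: bialgebra A + B: bialgebra B
  for A :: "('k::field, 'a, 'm) bialgebra_scheme"
    and B :: "('k, 'b, 'n) bialgebra_scheme"
    and h :: "'a \<Rightarrow> 'b" +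
  assumes hom: "h \<in> algebra_hom A B"
    and counit_compat: "x \<in> carrier A \<Longrightarrow> counit B (h x) = counit A x"
    and comult_compat: "x \<in> carrier A \<Longrightarrow> comult B (h x) = tensor_map B B h h (comult A x)"


section \<open>The group algebra and its Galois invariants\<close>

definition group_algebra_alg :: "('g, 'm) monoid_scheme \<Rightarrow> ('c::field, 'g \<Rightarrow>\<^sub>0 'c) module" where
  "group_algebra_alg H =
     \<lparr>carrier = {x. Poly_Mapping.keys x \<subseteq> carrier H},
      monoid.mult = (\<lambda>x y. \<Sum>s\<in>Poly_Mapping.keys x. \<Sum>t\<in>Poly_Mapping.keys y.
        Poly_Mapping.single (s \<otimes>\<^bsub>H\<^esub> t) (Poly_Mapping.lookup x s * Poly_Mapping.lookup y t)),
      one = Poly_Mapping.single \<one>\<^bsub>H\<^esub> 1,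
      ring.zero = 0,
      add = (+),
      module.smult = scale_pm\<rparr>"

definition group_algebra :: "('g, 'm) monoid_scheme \<Rightarrow> ('c::field, 'g \<Rightarrow>\<^sub>0 'c) bialgebra" where
  "group_algebra H = (let B = group_algebra_alg H in module.extend B
     (bialgebra.fields
       (\<lambda>x. tensor_class B B (\<Sum>s\<in>Poly_Mapping.keys x.
          Poly_Mapping.single (Poly_Mapping.single s 1, Poly_Mapping.single s 1)
            (Poly_Mapping.lookup x s)))
       (\<lambda>x. \<Sum>s\<in>Poly_Mapping.keys x. Poly_Mapping.lookup x s)))"

definition sigma_algebra :: "'c::field set \<Rightarrow> ('c, 'c \<Rightarrow>\<^sub>0 'c) bialgebra" where
  "sigma_algebra S = group_algebra ((units_of ring_of_type_algebra)\<lparr>carrier := S\<rparr>)"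

definition galois_act :: "('c \<Rightarrow> 'c) \<Rightarrow> ('c \<Rightarrow>\<^sub>0 'c) \<Rightarrow> ('c::field \<Rightarrow>\<^sub>0 'c)" where
  "galois_act \<sigma> x = (\<Sum>s\<in>Poly_Mapping.keys x.
     Poly_Mapping.single (\<sigma> s) (\<sigma> (Poly_Mapping.lookup x s)))"

definition restrict_scalars :: "('k \<Rightarrow> 'c) \<Rightarrow> ('c, 'a, 'm) module_scheme \<Rightarrow> ('k, 'a) module" where
  "restrict_scalars \<iota> M =
     \<lparr>carrier = carrier M, monoid.mult = monoid.mult M, one = one M, ring.zero = ring.zero M,
      add = add M, module.smult = (\<lambda>c. module.smult M (\<iota> c))\<rparr>"

definition invariant_alg ::
    "('k::field \<Rightarrow> 'c::field) \<Rightarrow> 'c set \<Rightarrow> ('k, 'c \<Rightarrow>\<^sub>0 'c) module" where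
  "invariant_alg \<iota> S = (restrict_scalars \<iota> (sigma_algebra S))
     \<lparr>carrier := {x \<in> carrier (sigma_algebra S). \<forall>\<sigma>\<in>galois_group \<iota>. galois_act \<sigma> x = x}\<rparr>"

text \<open>
  The coalgebra structure of the group algebra \<open>B\<close> over \<open>\<^bold>K\<close> restricted to the invariants \<open>A\<close>: the
  comultiplication of \<open>x\<close> is the element of \<open>A \<otimes>\<^sub>K A\<close> which the canonical map from
  \<open>A \<otimes>\<^sub>K A\<close> to the tensor square of \<open>B\<close> over \<open>\<^bold>K\<close> sends to the comultiplication of \<open>x\<close> in \<open>B\<close>.
\<close>

definition invariant_bialgebra ::
    "('k::field \<Rightarrow> 'c::field) \<Rightarrow> 'c set \<Rightarrow> ('k, 'c \<Rightarrow>\<^sub>0 'c) bialgebra" where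
  "invariant_bialgebra \<iota> S = (let A = invariant_alg \<iota> S; B = sigma_algebra S in module.extend A
     (bialgebra.fields
       (\<lambda>x. THE \<tau>. \<tau> \<in> carrier (tensor_product A A) \<and>
          tensor_lift (restrict_scalars \<iota> (tensor_product B B)) (pure_tensor B B) \<tau> = comult B x)
       (\<lambda>x. THE c. \<iota> c = counit B x)))"


section \<open>Linear recursive sequences\<close>

text \<open>The linear functional on \<open>K[t]\<close> with value \<open>f n\<close> at \<open>t\<^sup>n\<close>.\<close>

definition seq_functional :: "(nat \<Rightarrow> 'k::field) \<Rightarrow> 'k poly \<Rightarrow> 'k" where
  "seq_functional f p = (\<Sum>i\<le>Polynomial.degree p. Polynomial.coeff p i * f i)"

definition linear_recursive :: "(nat \<Rightarrow> 'k::field) set" where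
  "linear_recursive = {f. \<exists>m. Polynomial.lead_coeff m = 1 \<and> (\<forall>p. seq_functional f (m * p) = 0)}"

definition linrec_alg :: "('k::field, nat \<Rightarrow> 'k) module" where
  "linrec_alg =
     \<lparr>carrier = linear_recursive,
      monoid.mult = (\<lambda>f g n. f n * g n),
      one = (\<lambda>n. 1),
      ring.zero = (\<lambda>n. 0),
      add = (\<lambda>f g n. f n + g n),
      module.smult = (\<lambda>c f n. c * f n)\<rparr>"

text \<open>
  The comultiplication is dual to the multiplication of \<open>K[t]\<close>: that of \<open>f\<close> is the tensor
  whose pairing with \<open>p \<otimes> q\<close> is the value of \<open>f\<close> at \<open>p q\<close>.
\<close>

definition linrec_bialgebra :: "('k::field, nat \<Rightarrow> 'k) bialgebra" where
  "linrec_bialgebra = module.extend linrec_alg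
     (bialgebra.fields
       (\<lambda>f. THE \<tau>. \<tau> \<in> carrier (tensor_product linrec_alg linrec_alg) \<and>
          (\<forall>p q. tensor_lift scalar_algebra (\<lambda>g h. seq_functional g p * seq_functional h q) \<tau> =
                 seq_functional f (p * q)))
       (\<lambda>f. f 0))"

end

(*
  Write P_n(x) for the sum of a_s s^n over s, where x is the formal sum of a_s s. By the Vandermonde
  argument x is determined by its power sums P_n(x), n >= 0; multiplication is componentwise in n,
  the comultiplication becomes P_(i+j)(x), the counit P_0(x) and the antipode P_(-n)(x). An element
  of the group algebra is Galois invariant iff all its power sums lie in the fixed field K. So
  x |-> (P_n(x)) is injective into sequences over K, and all structure maps on both sides are given
  by the same formulas.

  Tensors over K are determined by the functions of two variables they induce, and such a function
  comes from a tensor as soon as its rows and columns come from the factors and its rank is finite,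
  even if the rank is measured over the algebraic closure. This gives the comultiplications without
  Galois descent; in turn, existence of the comultiplication shows that x |-> (P_n(x)) has finite
  Hankel rank, that is, is linear recursive.
*)

theory Submission
  imports Defs
begin

text \<open>Two features of the formal objects shape the argument. Tensors are cosets handled
  through arbitrary representatives, and two of the comultiplications are given by definite
  descriptions, so none of these maps can be computed with directly. Hence every module is equipped
  with an injective linear map into scalar functions on an index set, and identities are checked
  after evaluation. The index sets are additive monoids: the integers for the invariants, which
  makes room for negative exponents, and the naturals for sequences. The obvious decomposition of
  P_(i+j)(x) into terms a_s s^i s^j has terms that in general are not invariant one by one, so it
  exists only over the closure; this is why rank has to be allowed there. Galois theory enters only
  through the fixed field. If z is fixed, a polynomial of least degree over K with root z has no
  other root, since a second root would be the image of z under some automorphism (extended by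
  Zorn), and in characteristic zero z is a simple root. So the polynomial is linear.\<close>

abbreviation scalars :: "'k::field ring" where
  "scalars \<equiv> ring_of_type_algebra"

lemma scalars_simps [simp]:
  "carrier (scalars :: 'k::field ring) = UNIV" "x \<oplus>\<^bsub>scalars\<^esub> y = x + y" "x \<otimes>\<^bsub>scalars\<^esub> y = x * y"
  "\<one>\<^bsub>scalars\<^esub> = 1" "\<zero>\<^bsub>scalars\<^esub> = 0"
  by (simp_all add: ring_of_type_algebra_def)

lemma lookup_scale_pm [simp]:
  "Poly_Mapping.lookup (scale_pm c z) p = c * Poly_Mapping.lookup z p"
  by (simp add: Poly_Mapping.map.rep_eq when_def)

interpretation pm: Modules.module "scale_pm :: 'k::field \<Rightarrow> ('a \<Rightarrow>\<^sub>0 'k) \<Rightarrow> _"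
  by unfold_locales (auto intro!: poly_mapping_eqI simp: lookup_add algebra_simps)


section \<open>Modules of functions\<close>

definition lin_ext :: "('p \<Rightarrow> 'k::field) \<Rightarrow> ('p \<Rightarrow>\<^sub>0 'k) \<Rightarrow> 'k" where
  "lin_ext \<beta> z = (\<Sum>p\<in>Poly_Mapping.keys z. Poly_Mapping.lookup z p * \<beta> p)"

lemma lin_ext_superset:
  assumes "finite S" "Poly_Mapping.keys z \<subseteq> S"
  shows "lin_ext \<beta> z = (\<Sum>p\<in>S. Poly_Mapping.lookup z p * \<beta> p)"
  unfolding lin_ext_def using assms
  by (intro sum.mono_neutral_left) (auto simp: in_keys_iff)

lemma lin_ext_add: "lin_ext \<beta> (y + z) = lin_ext \<beta> y + lin_ext \<beta> z"
proof -
  let ?S = "Poly_Mapping.keys y \<union> Poly_Mapping.keys z"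
  have "lin_ext \<beta> (y + z) = (\<Sum>p\<in>?S. Poly_Mapping.lookup (y + z) p * \<beta> p)"
    by (rule lin_ext_superset) (use keys_add[of y z] in auto)
  moreover have "lin_ext \<beta> y = (\<Sum>p\<in>?S. Poly_Mapping.lookup y p * \<beta> p)"
    by (rule lin_ext_superset) auto
  moreover have "lin_ext \<beta> z = (\<Sum>p\<in>?S. Poly_Mapping.lookup z p * \<beta> p)"
    by (rule lin_ext_superset) auto
  ultimately show ?thesis
    by (simp add: lookup_add algebra_simps sum.distrib)
qed

lemma lin_ext_zero [simp]: "lin_ext \<beta> 0 = 0"
  by (simp add: lin_ext_def)

lemma keys_scale_pm: "Poly_Mapping.keys (scale_pm c z) \<subseteq> Poly_Mapping.keys z"
  by (auto simp: in_keys_iff)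

lemma lin_ext_scale: "lin_ext \<beta> (scale_pm c z) = c * lin_ext \<beta> z"
proof -
  have "lin_ext \<beta> (scale_pm c z) = (\<Sum>p\<in>Poly_Mapping.keys z. Poly_Mapping.lookup (scale_pm c z) p * \<beta> p)"
    by (rule lin_ext_superset) (auto intro: keys_scale_pm[THEN subsetD])
  then show ?thesis
    by (simp add: lin_ext_def sum_distrib_left mult.assoc)
qed

lemma lin_ext_diff: "lin_ext \<beta> (y - z) = lin_ext \<beta> y - lin_ext \<beta> z"
  using lin_ext_add[of \<beta> "y - z" z] by simp

lemma lin_ext_single [simp]: "lin_ext \<beta> (Poly_Mapping.single p c) = c * \<beta> p"
  by (simp add: lin_ext_def)

lemma lin_ext_sum: "lin_ext \<beta> (\<Sum>s\<in>S. z s) = (\<Sum>s\<in>S. lin_ext \<beta> (z s))"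
  by (induction S rule: infinite_finite_induct) (simp_all add: lin_ext_add)

lemma sum_single_lookup:
  "(\<Sum>p\<in>Poly_Mapping.keys z. Poly_Mapping.single p (Poly_Mapping.lookup z p)) = z"
  by (rule poly_mapping_eqI)
     (auto simp: lookup_sum lookup_single when_def in_keys_iff sum.delta)

text \<open>Vector space axioms are not assumed: \<open>e\<close> embeds the module into functions
  with pointwise operations, so every identity, and the existence of negatives, is inherited from
  the field.\<close>

locale coordinates =
  fixes M :: "('k::field, 'a, 'm) module_scheme" and e :: "'a \<Rightarrow> 'x \<Rightarrow> 'k"
  assumes zero_closed: "\<zero>\<^bsub>M\<^esub> \<in> carrier M"
    and add_closed: "\<lbrakk>x \<in> carrier M; y \<in> carrier M\<rbrakk> \<Longrightarrow> x \<oplus>\<^bsub>M\<^esub> y \<in> carrier M"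
    and smult_closed: "x \<in> carrier M \<Longrightarrow> c \<odot>\<^bsub>M\<^esub> x \<in> carrier M"
    and e_zero: "e \<zero>\<^bsub>M\<^esub> i = 0"
    and e_add: "\<lbrakk>x \<in> carrier M; y \<in> carrier M\<rbrakk> \<Longrightarrow> e (x \<oplus>\<^bsub>M\<^esub> y) i = e x i + e y i"
    and e_smult: "x \<in> carrier M \<Longrightarrow> e (c \<odot>\<^bsub>M\<^esub> x) i = c * e x i"
    and e_inject: "\<lbrakk>x \<in> carrier M; y \<in> carrier M; \<And>i. e x i = e y i\<rbrakk> \<Longrightarrow> x = y"
begin

lemmas closed = zero_closed add_closed smult_closed
lemmas e_simps = e_zero e_add e_smult

lemma is_abelian_group: "abelian_group M"
proof (rule abelian_groupI)
  fix x assume x: "x \<in> carrier M"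
  show "\<exists>y\<in>carrier M. y \<oplus>\<^bsub>M\<^esub> x = \<zero>\<^bsub>M\<^esub>"
    by (rule bexI[of _ "(- 1) \<odot>\<^bsub>M\<^esub> x"]) (auto intro!: e_inject closed simp: e_simps closed x)
qed (auto intro!: e_inject closed simp: e_simps closed)

lemma finsum_closed_e:
  assumes "finite S" "\<And>s. s \<in> S \<Longrightarrow> u s \<in> carrier M"
  shows "finsum M u S \<in> carrier M" "e (finsum M u S) i = (\<Sum>s\<in>S. e (u s) i)"
proof -
  interpret abelian_group M by (rule is_abelian_group)
  have "finsum M u S \<in> carrier M \<and> e (finsum M u S) i = (\<Sum>s\<in>S. e (u s) i)"
    using assms by (induction S rule: finite_induct) (simp_all add: e_simps Pi_def)
  then show "finsum M u S \<in> carrier M" "e (finsum M u S) i = (\<Sum>s\<in>S. e (u s) i)"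
    by auto
qed

text \<open>The sum is the body of \<open>tensor_lift\<close> with \<open>z\<close> as
  representative; evaluation turns a lift into a scalar linear extension.\<close>

lemma lin_ext_e:
  assumes "\<And>p. p \<in> Poly_Mapping.keys z \<Longrightarrow> \<beta> (fst p) (snd p) \<in> carrier M"
  shows "(\<Oplus>\<^bsub>M\<^esub>p\<in>Poly_Mapping.keys z. Poly_Mapping.lookup z p \<odot>\<^bsub>M\<^esub> \<beta> (fst p) (snd p)) \<in> carrier M"
    and "e (\<Oplus>\<^bsub>M\<^esub>p\<in>Poly_Mapping.keys z. Poly_Mapping.lookup z p \<odot>\<^bsub>M\<^esub> \<beta> (fst p) (snd p)) i =
         lin_ext (\<lambda>p. e (\<beta> (fst p) (snd p)) i) z"
  using assms by (simp_all add: finsum_closed_e closed e_simps lin_ext_def)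

end

locale algebra_coordinates = coordinates +
  assumes one_closed: "\<one>\<^bsub>M\<^esub> \<in> carrier M"
    and mult_closed: "\<lbrakk>x \<in> carrier M; y \<in> carrier M\<rbrakk> \<Longrightarrow> x \<otimes>\<^bsub>M\<^esub> y \<in> carrier M"
    and e_one: "e \<one>\<^bsub>M\<^esub> i = 1"
    and e_mult: "\<lbrakk>x \<in> carrier M; y \<in> carrier M\<rbrakk> \<Longrightarrow> e (x \<otimes>\<^bsub>M\<^esub> y) i = e x i * e y i"
begin

lemma is_algebra: "algebra scalars M"
proof (rule algebraI)
  have "comm_monoid M"
    by (rule comm_monoidI)
       (auto intro!: e_inject closed one_closed mult_closed
             simp: e_simps e_one e_mult closed one_closed mult_closed)
  then show "cring M"
    by (intro cringI is_abelian_group)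
       (auto intro!: e_inject closed mult_closed simp: e_simps e_mult closed mult_closed algebra_simps)
qed (auto intro!: e_inject closed mult_closed simp: e_simps e_mult closed mult_closed algebra_simps)

end

lemma scalar_algebra_eq:
  "(scalar_algebra :: ('k::field, 'k) module) =
     \<lparr>carrier = UNIV, monoid.mult = (*), one = 1, ring.zero = 0, add = (+), module.smult = (*)\<rparr>"
  by (simp add: scalar_algebra_def ring.defs module.defs ring_of_type_algebra_def)

lemma coordinates_scalar_algebra: "algebra_coordinates (scalar_algebra :: ('k::field, 'k) module) (\<lambda>c _. c)"
  by unfold_locales (simp_all add: scalar_algebra_eq)

lemma tensor_lift_scalar:
  "tensor_lift scalar_algebra \<beta> U = lin_ext (\<lambda>p. \<beta> (fst p) (snd p)) (tensor_rep U)"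
proof -
  interpret algebra_coordinates scalar_algebra "\<lambda>c (_::unit). c"
    by (rule coordinates_scalar_algebra)
  show ?thesis
    unfolding tensor_lift_def
    by (rule lin_ext_e(2)) (simp add: scalar_algebra_eq)
qed


section \<open>Tensor products of modules of functions\<close>

text \<open>The two-variable function of a tensor, where x \<otimes> y gives e x i * f y j. It is
  read off the arbitrary representative; \<open>eval_class\<close> shows that the choice does not
  matter.\<close>

definition tensor_eval ::
    "('a \<Rightarrow> 'x \<Rightarrow> 'k::field) \<Rightarrow> ('b \<Rightarrow> 'y \<Rightarrow> 'k) \<Rightarrow> ('a \<times> 'b \<Rightarrow>\<^sub>0 'k) set \<Rightarrow> 'x \<times> 'y \<Rightarrow> 'k" where
  "tensor_eval e f U = (\<lambda>ij. lin_ext (\<lambda>p. e (fst p) (fst ij) * f (snd p) (snd ij)) (tensor_rep U))"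

locale tensor_coordinates = M: coordinates M e + N: coordinates N f
  for M :: "('k::field, 'a, 'm) module_scheme" and e :: "'a \<Rightarrow> 'x \<Rightarrow> 'k"
    and N :: "('k, 'b, 'n) module_scheme" and f :: "'b \<Rightarrow> 'y \<Rightarrow> 'k"
begin

definition bil :: "'x \<times> 'y \<Rightarrow> 'a \<times> 'b \<Rightarrow> 'k" where
  "bil ij p = e (fst p) (fst ij) * f (snd p) (snd ij)"

abbreviation relators where "relators \<equiv> tensor_relators M N"
abbreviation TP where "TP \<equiv> tensor_product M N"
abbreviation C where "C \<equiv> {z :: 'a \<times> 'b \<Rightarrow>\<^sub>0 'k. Poly_Mapping.keys z \<subseteq> carrier M \<times> carrier N}"

lemma single_in_C: "x \<in> carrier M \<Longrightarrow> y \<in> carrier N \<Longrightarrow> Poly_Mapping.single (x, y) c \<in> C"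
  by (auto simp: keys_single split: if_splits)

lemma subspace_C: "pm.subspace C"
  by (auto simp: pm.subspace_def dest!: keys_add[THEN subsetD] keys_scale_pm[THEN subsetD])

lemmas C_diff = pm.subspace_diff[OF subspace_C]
lemmas C_add = pm.subspace_add[OF subspace_C]
lemmas C_scale = pm.subspace_scale[OF subspace_C]
lemmas C_sum = pm.subspace_sum[OF subspace_C]

lemma relators_in_C: "relators \<subseteq> C"
  unfolding tensor_relators_def
  by (intro Un_least subsetI; elim CollectE exE conjE; hypsubst; intro C_diff single_in_C)
     (simp_all add: M.closed N.closed)

lemma span_in_C: "pm.span relators \<subseteq> C"
  using relators_in_C subspace_C by (rule pm.span_minimal)

text \<open>Each relator expresses linearity in one factor, and \<open>bil ij\<close> is linear in
  both.\<close>

lemma lin_ext_bil_span: "z \<in> pm.span relators \<Longrightarrow> lin_ext (bil ij) z = 0"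
proof (induction rule: pm.span_induct)
  case base
  show ?case by (auto simp: pm.subspace_def lin_ext_add lin_ext_scale)
next
  case (step z)
  have "lin_ext (bil ij) z = 0" if "z \<in> relators" for z
    using that unfolding tensor_relators_def
    by (elim UnE CollectE exE conjE; hypsubst)
       (simp_all add: lin_ext_diff bil_def M.e_simps N.e_simps M.closed N.closed
          distrib_left distrib_right mult.left_commute)
  with step show ?case by blast
qed

lemma class_eq_iff: "tensor_class M N y = tensor_class M N z \<longleftrightarrow> y - z \<in> pm.span relators"
proof
  assume eq: "tensor_class M N y = tensor_class M N z"
  have "y \<in> tensor_class M N y"
    unfolding tensor_class_def by (rule image_eqI[of _ _ 0]) (auto intro: pm.span_zero)
  with eq show "y - z \<in> pm.span relators"
    by (auto simp: tensor_class_def)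
next
  have *: "tensor_class M N y \<subseteq> tensor_class M N z" if "y - z \<in> pm.span relators" for y z
    unfolding tensor_class_def
  proof safe
    fix u assume "u \<in> pm.span relators"
    with that have "(y - z) + u \<in> pm.span relators" by (rule pm.span_add)
    then show "y + u \<in> (+) z ` pm.span relators"
      by (intro image_eqI[of _ _ "(y - z) + u"]) auto
  qed
  assume yz: "y - z \<in> pm.span relators"
  then have "z - y \<in> pm.span relators"
    using pm.span_neg by fastforce
  with yz show "tensor_class M N y = tensor_class M N z"
    by (intro equalityI *)
qed

lemma rep_class: "tensor_rep (tensor_class M N z) - z \<in> pm.span relators"
proof -
  have "z \<in> tensor_class M N z"
    unfolding tensor_class_def by (rule image_eqI[of _ _ 0]) (auto intro: pm.span_zero)
  then have "tensor_rep (tensor_class M N z) \<in> tensor_class M N z"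
    unfolding tensor_rep_def by (rule someI)
  then show ?thesis by (auto simp: tensor_class_def)
qed

lemma carrier_TP: "carrier TP = tensor_class M N ` C"
  by (simp add: tensor_product_def)

lemma class_in_TP: "z \<in> C \<Longrightarrow> tensor_class M N z \<in> carrier TP"
  by (simp add: carrier_TP)

text \<open>An arbitrary element of the coset might involve pairs outside the carriers; it does not,
  because the relators, and so their span, lie in \<open>C\<close>.\<close>

lemma rep_in_C: "U \<in> carrier TP \<Longrightarrow> tensor_rep U \<in> C"
proof -
  assume "U \<in> carrier TP"
  then obtain z where z: "z \<in> C" "U = tensor_class M N z" by (auto simp: carrier_TP)
  have "tensor_rep U - z \<in> C"
    using rep_class span_in_C z(2) by blast
  then have "(tensor_rep U - z) + z \<in> C"
    using z(1) by (rule C_add)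
  then show ?thesis by simp
qed

lemma eval_class: "tensor_eval e f (tensor_class M N z) ij = lin_ext (bil ij) z"
  using lin_ext_bil_span[OF rep_class[of z], of ij]
  by (simp add: tensor_eval_def bil_def[abs_def] lin_ext_diff)

lemma eval_rep: "lin_ext (bil ij) (tensor_rep U) = tensor_eval e f U ij"
  by (simp add: tensor_eval_def bil_def[abs_def])

lemma pure_closed: "x \<in> carrier M \<Longrightarrow> y \<in> carrier N \<Longrightarrow> pure_tensor M N x y \<in> carrier TP"
  unfolding pure_tensor_def by (intro class_in_TP single_in_C)

lemma eval_pure: "tensor_eval e f (pure_tensor M N x y) ij = e x (fst ij) * f y (snd ij)"
  by (simp add: pure_tensor_def eval_class bil_def)

lemma span_add_left:
  assumes "x \<in> carrier M" "x' \<in> carrier M" "y \<in> carrier N"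
  shows "Poly_Mapping.single (x \<oplus>\<^bsub>M\<^esub> x', y) 1 - Poly_Mapping.single (x, y) 1
           - Poly_Mapping.single (x', y) 1 \<in> pm.span relators"
  unfolding tensor_relators_def using assms by (intro pm.span_base) blast

lemma span_add_right:
  assumes "x \<in> carrier M" "y \<in> carrier N" "y' \<in> carrier N"
  shows "Poly_Mapping.single (x, y \<oplus>\<^bsub>N\<^esub> y') 1 - Poly_Mapping.single (x, y) 1
           - Poly_Mapping.single (x, y') 1 \<in> pm.span relators"
  unfolding tensor_relators_def using assms by (intro pm.span_base) blast

lemma span_smult_left:
  assumes "x \<in> carrier M" "y \<in> carrier N"
  shows "Poly_Mapping.single (c \<odot>\<^bsub>M\<^esub> x, y) 1 - Poly_Mapping.single (x, y) c \<in> pm.span relators"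
  unfolding tensor_relators_def using assms by (intro pm.span_base) blast

lemma span_smult_right:
  assumes "x \<in> carrier M" "y \<in> carrier N"
  shows "Poly_Mapping.single (x, c \<odot>\<^bsub>N\<^esub> y) 1 - Poly_Mapping.single (x, y) c \<in> pm.span relators"
  unfolding tensor_relators_def using assms by (intro pm.span_base) blast

text \<open>Left linearity for a whole combination. The element x is built along with the
  congruence, so that its evaluations and its class are known for the same x.\<close>

lemma ex_combination:
  assumes "finite S" "\<And>s. s \<in> S \<Longrightarrow> v s \<in> carrier M" "y \<in> carrier N"
  shows "\<exists>x\<in>carrier M. (\<forall>i. e x i = (\<Sum>s\<in>S. c s * e (v s) i)) \<and>
    Poly_Mapping.single (x, y) 1 - (\<Sum>s\<in>S. Poly_Mapping.single (v s, y) (c s)) \<in> pm.span relators"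
  using assms
proof (induction S rule: finite_induct)
  case empty
  \<comment> \<open>Writing zero as a multiple by the scalar 0 yields a relator whose second term
    vanishes.\<close>
  have "Poly_Mapping.single (0 \<odot>\<^bsub>M\<^esub> \<zero>\<^bsub>M\<^esub>, y) 1 - Poly_Mapping.single (\<zero>\<^bsub>M\<^esub>, y) 0 \<in> pm.span relators"
    using empty by (intro span_smult_left M.closed)
  then show ?case
    by (intro bexI[of _ "0 \<odot>\<^bsub>M\<^esub> \<zero>\<^bsub>M\<^esub>"]) (simp_all add: M.e_simps M.closed)
next
  case (insert s S)
  then obtain x where x: "x \<in> carrier M" "\<And>i. e x i = (\<Sum>s\<in>S. c s * e (v s) i)"
    "Poly_Mapping.single (x, y) 1 - (\<Sum>s\<in>S. Poly_Mapping.single (v s, y) (c s)) \<in> pm.span relators"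
    by auto
  have s: "v s \<in> carrier M" using insert by auto
  \<comment> \<open>An additive relator, a scalar relator and the induction hypothesis
    telescope.\<close>
  have "(Poly_Mapping.single (c s \<odot>\<^bsub>M\<^esub> v s \<oplus>\<^bsub>M\<^esub> x, y) 1 - Poly_Mapping.single (c s \<odot>\<^bsub>M\<^esub> v s, y) 1
           - Poly_Mapping.single (x, y) 1)
      + (Poly_Mapping.single (c s \<odot>\<^bsub>M\<^esub> v s, y) 1 - Poly_Mapping.single (v s, y) (c s))
      + (Poly_Mapping.single (x, y) 1 - (\<Sum>s\<in>S. Poly_Mapping.single (v s, y) (c s))) \<in> pm.span relators"
    using insert s x by (intro pm.span_add span_add_left span_smult_left M.closed) auto
  then show ?case
    using insert s x
    by (intro bexI[of _ "c s \<odot>\<^bsub>M\<^esub> v s \<oplus>\<^bsub>M\<^esub> x"]) (simp_all add: M.e_simps M.closed algebra_simps)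
qed

text \<open>A relation among the evaluations lets one factor of the last term be solved for, which shortens the sum.\<close>

lemma sum_in_span:
  assumes "finite S" "\<And>s. s \<in> S \<Longrightarrow> v s \<in> carrier M" "\<And>s. s \<in> S \<Longrightarrow> w s \<in> carrier N"
    and "\<And>i j. (\<Sum>s\<in>S. e (v s) i * f (w s) j) = 0"
  shows "(\<Sum>s\<in>S. Poly_Mapping.single (v s, w s) 1) \<in> pm.span relators"
  using assms
proof (induction S arbitrary: w rule: finite_induct)
  case empty
  then show ?case by (simp add: pm.span_zero)
next
  case (insert t S)
  have t: "v t \<in> carrier M" "w t \<in> carrier N"
    and S: "\<And>s. s \<in> S \<Longrightarrow> v s \<in> carrier M" "\<And>s. s \<in> S \<Longrightarrow> w s \<in> carrier N"
    using insert.prems by auto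
  have rel: "e (v t) i * f (w t) j + (\<Sum>s\<in>S. e (v s) i * f (w s) j) = 0" for i j
    using insert.prems(3)[of i j] insert.hyps by simp
  show ?case
  proof (cases "\<forall>j. f (w t) j = 0")
    case True
    \<comment> \<open>A second factor with vanishing evaluations is 0 times itself, and the relator
      for the scalar 0 reduces to its first term.\<close>
    then have "w t = 0 \<odot>\<^bsub>N\<^esub> w t"
      using t by (intro N.e_inject N.closed) (auto simp: N.e_simps)
    then have "Poly_Mapping.single (v t, w t) 1 \<in> pm.span relators"
      using span_smult_right[OF t, of 0] by simp
    moreover have "(\<Sum>s\<in>S. Poly_Mapping.single (v s, w s) 1) \<in> pm.span relators"
      using True rel S by (intro insert.IH) auto
    ultimately show ?thesis
      using insert.hyps by (simp add: pm.span_add)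
  next
    case False
    then obtain j0 where j0: "f (w t) j0 \<noteq> 0" by auto
    \<comment> \<open>The relation at column \<open>j0\<close>, divided by f (w t) j0, expresses v t
      through the other v s with these coefficients.\<close>
    define c where "c s = - f (w s) j0 / f (w t) j0" for s
    obtain x where x: "x \<in> carrier M" "\<And>i. e x i = (\<Sum>s\<in>S. c s * e (v s) i)"
      "Poly_Mapping.single (x, w t) 1 - (\<Sum>s\<in>S. Poly_Mapping.single (v s, w t) (c s)) \<in> pm.span relators"
      using ex_combination[where v = v and c = c, OF insert.hyps(1) S(1) t(2)] by auto
    have e_t: "e (v t) i = (\<Sum>s\<in>S. c s * e (v s) i)" for i
    proof -
      have "(\<Sum>s\<in>S. c s * e (v s) i) = - (\<Sum>s\<in>S. e (v s) i * f (w s) j0) / f (w t) j0"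
        by (simp add: c_def sum_divide_distrib sum_negf mult.commute)
      with rel[of i j0] j0 show ?thesis
        by (simp add: field_simps add_eq_0_iff)
    qed
    have xt: "x = v t"
      using x e_t t by (intro M.e_inject) auto
    \<comment> \<open>Substituting the combination for v t and collecting terms by v s replaces w s
      by w' s.\<close>
    define w' where "w' s = w s \<oplus>\<^bsub>N\<^esub> c s \<odot>\<^bsub>N\<^esub> w t" for s
    have "(\<Sum>s\<in>S. e (v s) i * f (w' s) j) = 0" for i j
    proof -
      have "(\<Sum>s\<in>S. e (v s) i * f (w' s) j) =
          (\<Sum>s\<in>S. e (v s) i * f (w s) j) + (\<Sum>s\<in>S. c s * e (v s) i) * f (w t) j"
        using S t by (simp add: w'_def N.e_simps N.closed algebra_simps sum.distrib sum_distrib_left)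
      with rel[of i j] show ?thesis by (simp add: e_t add.commute)
    qed
    then have IH: "(\<Sum>s\<in>S. Poly_Mapping.single (v s, w' s) 1) \<in> pm.span relators"
      using S t by (intro insert.IH) (auto simp: w'_def intro!: N.closed)
    have "(\<Sum>s\<in>S. (Poly_Mapping.single (v s, w' s) 1 - Poly_Mapping.single (v s, w s) 1
              - Poly_Mapping.single (v s, c s \<odot>\<^bsub>N\<^esub> w t) 1)
            + (Poly_Mapping.single (v s, c s \<odot>\<^bsub>N\<^esub> w t) 1 - Poly_Mapping.single (v s, w t) (c s)))
          \<in> pm.span relators"
      unfolding w'_def using S t
      by (intro pm.span_sum pm.span_add span_add_right span_smult_right N.closed) auto
    then have d: "(\<Sum>s\<in>S. Poly_Mapping.single (v s, w' s) 1) - (\<Sum>s\<in>S. Poly_Mapping.single (v s, w s) 1)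
            - (\<Sum>s\<in>S. Poly_Mapping.single (v s, w t) (c s)) \<in> pm.span relators"
      by (simp add: sum_subtractf)
    \<comment> \<open>The substitution is undone modulo relators: the sums with w' and those with w
      t cancel, leaving the original sum and the term of t.\<close>
    have "(\<Sum>s\<in>S. Poly_Mapping.single (v s, w' s) 1)
         - ((\<Sum>s\<in>S. Poly_Mapping.single (v s, w' s) 1) - (\<Sum>s\<in>S. Poly_Mapping.single (v s, w s) 1)
            - (\<Sum>s\<in>S. Poly_Mapping.single (v s, w t) (c s)))
         + (Poly_Mapping.single (x, w t) 1 - (\<Sum>s\<in>S. Poly_Mapping.single (v s, w t) (c s)))
         \<in> pm.span relators"
      by (rule pm.span_add[OF pm.span_diff[OF IH d] x(3)])
    then show ?thesis
      using insert.hyps by (simp add: xt algebra_simps)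
  qed
qed

text \<open>The coefficients are absorbed into the second factors, which brings z into the form with
  unit coefficients treated by \<open>sum_in_span\<close>.\<close>

lemma in_span:
  assumes "z \<in> C" "\<And>ij. lin_ext (bil ij) z = 0"
  shows "z \<in> pm.span relators"
proof -
  define K where "K = Poly_Mapping.keys z"
  define w where "w p = Poly_Mapping.lookup z p \<odot>\<^bsub>N\<^esub> snd p" for p
  have K: "fst p \<in> carrier M" "snd p \<in> carrier N" if "p \<in> K" for p
    using assms(1) that by (auto simp: K_def)
  have "(\<Sum>p\<in>K. e (fst p) i * f (w p) j) = 0" for i j
    using assms(2)[of "(i, j)"] K
    by (simp add: w_def N.e_simps lin_ext_def bil_def K_def mult.left_commute)
  then have 1: "(\<Sum>p\<in>K. Poly_Mapping.single (fst p, w p) 1) \<in> pm.span relators"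
    using K by (intro sum_in_span) (auto simp: w_def K_def intro!: N.closed)
  have 2: "(\<Sum>p\<in>K. Poly_Mapping.single (fst p, w p) 1 - Poly_Mapping.single (fst p, snd p) (Poly_Mapping.lookup z p))
       \<in> pm.span relators"
    unfolding w_def using K by (intro pm.span_sum span_smult_right)
  have "z = (\<Sum>p\<in>K. Poly_Mapping.single (fst p, w p) 1)
      - (\<Sum>p\<in>K. Poly_Mapping.single (fst p, w p) 1 - Poly_Mapping.single (fst p, snd p) (Poly_Mapping.lookup z p))"
    by (simp add: sum_subtractf sum_single_lookup K_def)
  then show ?thesis
    using pm.span_diff[OF 1 2] by simp
qed

lemma tensor_eqI:
  assumes "U \<in> carrier TP" "V \<in> carrier TP" "\<And>ij. tensor_eval e f U ij = tensor_eval e f V ij"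
  shows "U = V"
proof -
  obtain y z where yz: "y \<in> C" "z \<in> C" "U = tensor_class M N y" "V = tensor_class M N z"
    using assms(1,2) by (auto simp: carrier_TP)
  have "y - z \<in> pm.span relators"
    using assms(3) yz by (intro in_span C_diff) (auto simp: eval_class lin_ext_diff)
  then show ?thesis by (simp add: yz class_eq_iff)
qed

text \<open>A tensor product is again a module of functions, so the construction iterates;
  coassociativity relies on this for threefold products.\<close>

lemma coordinates_tensor: "coordinates TP (tensor_eval e f)"
proof
  show "\<zero>\<^bsub>TP\<^esub> \<in> carrier TP"
    unfolding carrier_TP by (auto simp: tensor_product_def)
  show "tensor_eval e f \<zero>\<^bsub>TP\<^esub> ij = 0" for ij
    by (simp add: tensor_product_def eval_class)
next
  fix U V ij c assume UV: "U \<in> carrier TP" "V \<in> carrier TP"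
  have add: "U \<oplus>\<^bsub>TP\<^esub> V = tensor_class M N (tensor_rep U + tensor_rep V)"
    by (simp add: tensor_product_def)
  show "U \<oplus>\<^bsub>TP\<^esub> V \<in> carrier TP"
    unfolding add using UV by (intro class_in_TP C_add rep_in_C)
  show "tensor_eval e f (U \<oplus>\<^bsub>TP\<^esub> V) ij = tensor_eval e f U ij + tensor_eval e f V ij"
    by (simp add: add eval_class lin_ext_add eval_rep)
next
  fix U ij c assume U: "U \<in> carrier TP"
  have smult: "c \<odot>\<^bsub>TP\<^esub> U = tensor_class M N (scale_pm c (tensor_rep U))"
    by (simp add: tensor_product_def)
  show "c \<odot>\<^bsub>TP\<^esub> U \<in> carrier TP"
    unfolding smult using U by (intro class_in_TP C_scale rep_in_C)
  show "tensor_eval e f (c \<odot>\<^bsub>TP\<^esub> U) ij = c * tensor_eval e f U ij"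
    by (simp add: smult eval_class lin_ext_scale eval_rep)
qed (rule tensor_eqI)

text \<open>The right-hand side still mentions the representative. In applications
  \<open>lin_ext_rep_cong\<close> rewrites the function to a product of evaluations, and
  \<open>eval_rep'\<close> then removes the representative.\<close>

lemma tensor_lift_e:
  assumes "coordinates P g" "U \<in> carrier TP"
    and "\<And>x y. \<lbrakk>x \<in> carrier M; y \<in> carrier N\<rbrakk> \<Longrightarrow> \<beta> x y \<in> carrier P"
  shows "tensor_lift P \<beta> U \<in> carrier P"
    and "g (tensor_lift P \<beta> U) i = lin_ext (\<lambda>p. g (\<beta> (fst p) (snd p)) i) (tensor_rep U)"
proof -
  interpret P: coordinates P g by fact
  have "\<beta> (fst p) (snd p) \<in> carrier P" if "p \<in> Poly_Mapping.keys (tensor_rep U)" for p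
    using rep_in_C[OF assms(2)] that assms(3) by auto
  then show "tensor_lift P \<beta> U \<in> carrier P"
    and "g (tensor_lift P \<beta> U) i = lin_ext (\<lambda>p. g (\<beta> (fst p) (snd p)) i) (tensor_rep U)"
    unfolding tensor_lift_def by (auto intro!: P.lin_ext_e)
qed

lemma lin_ext_rep_cong:
  assumes "U \<in> carrier TP" "\<And>x y. \<lbrakk>x \<in> carrier M; y \<in> carrier N\<rbrakk> \<Longrightarrow> \<beta> (x, y) = \<gamma> (x, y)"
  shows "lin_ext \<beta> (tensor_rep U) = lin_ext \<gamma> (tensor_rep U)"
  unfolding lin_ext_def using rep_in_C[OF assms(1)] assms(2)
  by (intro sum.cong) auto

lemma eval_rep': "lin_ext (\<lambda>p. e (fst p) i * f (snd p) j) (tensor_rep U) = tensor_eval e f U (i, j)"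
  by (simp add: tensor_eval_def)

end

locale tensor_algebra_coordinates =
  M: algebra_coordinates M e + N: algebra_coordinates N f + tensor_coordinates M e N f
  for M :: "('k::field, 'a, 'm) module_scheme" and e :: "'a \<Rightarrow> 'x \<Rightarrow> 'k"
    and N :: "('k, 'b, 'n) module_scheme" and f :: "'b \<Rightarrow> 'y \<Rightarrow> 'k"
begin

lemma algebra_coordinates_tensor: "algebra_coordinates TP (tensor_eval e f)"
proof -
  interpret T: coordinates TP "tensor_eval e f" by (rule coordinates_tensor)
  show ?thesis
  proof
    have one: "\<one>\<^bsub>TP\<^esub> = pure_tensor M N \<one>\<^bsub>M\<^esub> \<one>\<^bsub>N\<^esub>"
      by (simp add: tensor_product_def)
    show "\<one>\<^bsub>TP\<^esub> \<in> carrier TP"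
      unfolding one by (intro pure_closed M.one_closed N.one_closed)
    show "tensor_eval e f \<one>\<^bsub>TP\<^esub> ij = 1" for ij
      by (simp add: one eval_pure M.e_one N.e_one)
  next
    fix U V ij assume UV: "U \<in> carrier TP" "V \<in> carrier TP"
    let ?u = "tensor_rep U" and ?v = "tensor_rep V"
    have mult: "U \<otimes>\<^bsub>TP\<^esub> V = tensor_class M N
        (\<Sum>p\<in>Poly_Mapping.keys ?u. \<Sum>q\<in>Poly_Mapping.keys ?v.
           Poly_Mapping.single (fst p \<otimes>\<^bsub>M\<^esub> fst q, snd p \<otimes>\<^bsub>N\<^esub> snd q)
             (Poly_Mapping.lookup ?u p * Poly_Mapping.lookup ?v q))"
      by (simp add: tensor_product_def)
    have keys: "fst p \<in> carrier M" "snd p \<in> carrier N" if "p \<in> Poly_Mapping.keys ?u \<or> p \<in> Poly_Mapping.keys ?v" for p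
      using rep_in_C[OF UV(1)] rep_in_C[OF UV(2)] that by auto
    show "U \<otimes>\<^bsub>TP\<^esub> V \<in> carrier TP"
      unfolding mult using keys
      by (intro class_in_TP C_sum single_in_C M.mult_closed N.mult_closed) auto
    have "tensor_eval e f (U \<otimes>\<^bsub>TP\<^esub> V) ij = (\<Sum>p\<in>Poly_Mapping.keys ?u. \<Sum>q\<in>Poly_Mapping.keys ?v.
        (Poly_Mapping.lookup ?u p * bil ij p) * (Poly_Mapping.lookup ?v q * bil ij q))"
      unfolding mult eval_class lin_ext_sum using keys
      by (intro sum.cong) (auto simp: bil_def M.e_mult N.e_mult)
    also have "\<dots> = lin_ext (bil ij) ?u * lin_ext (bil ij) ?v"
      by (simp add: lin_ext_def sum_product)
    finally show "tensor_eval e f (U \<otimes>\<^bsub>TP\<^esub> V) ij = tensor_eval e f U ij * tensor_eval e f V ij"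
      by (simp add: eval_rep)
  qed
qed

end


section \<open>Embeddings of fields\<close>

locale field_embedding =
  fixes \<iota> :: "'k::field \<Rightarrow> 'l::field"
  assumes ring_hom: "\<iota> \<in> ring_hom scalars scalars"
begin

lemma emb_add: "\<iota> (x + y) = \<iota> x + \<iota> y"
  and emb_mult: "\<iota> (x * y) = \<iota> x * \<iota> y"
  and emb_one: "\<iota> 1 = 1"
  using ring_hom_add[OF ring_hom, of x y] ring_hom_mult[OF ring_hom, of x y] ring_hom_one[OF ring_hom]
  by simp_all

lemma emb_zero: "\<iota> 0 = 0"
  using emb_add[of 0 0] by (metis add.right_neutral add_left_cancel)

lemma emb_diff: "\<iota> (x - y) = \<iota> x - \<iota> y"
  using emb_add[of "x - y" y] by simp

lemma emb_minus: "\<iota> (- x) = - \<iota> x"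
  using emb_diff[of 0 x] by (simp add: emb_zero)

lemma emb_eq_0_iff: "\<iota> x = 0 \<longleftrightarrow> x = 0"
  using emb_mult[of x "inverse x"] by (cases "x = 0") (auto simp: emb_zero emb_one)

lemma emb_eq_iff: "\<iota> x = \<iota> y \<longleftrightarrow> x = y"
  using emb_eq_0_iff[of "x - y"] by (simp add: emb_diff)

lemma emb_inverse: "\<iota> (inverse x) = inverse (\<iota> x)"
  using emb_mult[of x "inverse x"]
  by (cases "x = 0") (auto simp: emb_zero emb_one emb_eq_0_iff field_simps)

lemma emb_divide: "\<iota> (x / y) = \<iota> x / \<iota> y"
  by (simp add: divide_inverse emb_mult emb_inverse)

lemma emb_sum: "\<iota> (\<Sum>s\<in>S. f s) = (\<Sum>s\<in>S. \<iota> (f s))"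
  by (induction S rule: infinite_finite_induct) (simp_all add: emb_zero emb_add)

lemma emb_power: "\<iota> (x ^ n) = \<iota> x ^ n"
  by (induction n) (simp_all add: emb_one emb_mult)

lemma emb_power_int: "\<iota> (x powi n) = \<iota> x powi n"
  by (simp add: power_int_def emb_power emb_inverse)

lemma emb_of_nat: "\<iota> (of_nat n) = of_nat n"
  by (induction n) (simp_all add: emb_zero emb_one emb_add)

lemmas emb_simps = emb_add emb_mult emb_one emb_zero emb_diff emb_minus emb_eq_0_iff emb_eq_iff
  emb_inverse emb_divide emb_sum emb_power emb_power_int emb_of_nat

end


section \<open>Tensors from matrices of finite rank\<close>

text \<open>
  The rank may be measured over an extension field: eliminating with entries of the matrix itself,
  which lie in the small field, peels off one tensor \<open>v \<otimes> w\<close> at a time (Wedderburn's rank reduction).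
\<close>

lemma (in tensor_coordinates) ex_tensor_of_finite_rank:
  fixes \<iota> :: "'k \<Rightarrow> 'l::field" and a :: "'s \<Rightarrow> 'x \<Rightarrow> 'l" and b :: "'s \<Rightarrow> 'y \<Rightarrow> 'l"
  assumes \<iota>: "field_embedding \<iota>"
    and "finite S"
    and "\<And>i j. \<iota> (F i j) = (\<Sum>s\<in>S. a s i * b s j)"
    and "\<And>j. \<exists>v\<in>carrier M. \<forall>i. e v i = F i j"
    and "\<And>i. \<exists>w\<in>carrier N. \<forall>j. f w j = F i j"
  shows "\<exists>\<tau>\<in>carrier TP. \<forall>i j. tensor_eval e f \<tau> (i, j) = F i j"
proof -
  interpret field_embedding \<iota> by fact
  show ?thesis
    using assms(2-)
  proof (induction S arbitrary: F a b rule: finite_induct)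
    case empty
    interpret T: coordinates TP "tensor_eval e f" by (rule coordinates_tensor)
    have "F i j = 0" for i j
      using empty(1)[of i j] by (simp add: emb_eq_0_iff)
    then show ?case
      by (intro bexI[of _ "\<zero>\<^bsub>TP\<^esub>"]) (simp_all add: T.closed T.e_simps)
  next
    case (insert t S)
    interpret T: coordinates TP "tensor_eval e f" by (rule coordinates_tensor)
    have F: "\<iota> (F i j) = a t i * b t j + (\<Sum>s\<in>S. a s i * b s j)" for i j
      using insert.prems(1)[of i j] insert.hyps by simp
    show ?case
    proof (cases "\<forall>i. a t i = 0")
      case True
      then show ?thesis
        using F insert.prems by (intro insert.IH[of F a b]) simp_all
    next
      case False
      then obtain i0 where i0: "a t i0 \<noteq> 0" by auto
      \<comment> \<open>Row \<open>i0\<close> can be solved for b t j. Inserting the result removes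
        the index t at the price of a multiple of row \<open>i0\<close>.\<close>
      define a' where "a' s i = a s i - a t i * a s i0 / a t i0" for s i
      have F': "\<iota> (F i j) = (\<Sum>s\<in>S. a' s i * b s j) + a t i / a t i0 * \<iota> (F i0 j)" for i j
        unfolding F[of i0] using i0
        by (simp add: F[of i] a'_def left_diff_distrib sum_subtractf distrib_left sum_distrib_left mult.assoc)
      show ?thesis
      proof (cases "\<forall>j. F i0 j = 0")
        case True
        then show ?thesis
          using F' insert.prems by (intro insert.IH[of F a' b]) (auto simp: emb_zero)
      next
        case False
        then obtain j0 where j0: "F i0 j0 \<noteq> 0" by auto
        \<comment> \<open>Subtracting column \<open>j0\<close> times row \<open>i0\<close>, divided
          by the pivot, cancels that multiple of row \<open>i0\<close>, so G is a sum over S alone.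
          Rows and columns of G are combinations of those of F and hence still come from the
          factors.\<close>
        define G where "G i j = F i j - F i j0 / F i0 j0 * F i0 j" for i j
        define b' where "b' s j = b s j - b s j0 / \<iota> (F i0 j0) * \<iota> (F i0 j)" for s j
        have \<iota>j0: "\<iota> (F i0 j0) \<noteq> 0"
          using j0 by (simp add: emb_eq_0_iff)
        obtain v where v: "v \<in> carrier M" "\<And>i. e v i = F i j0"
          using insert.prems(2) by meson
        obtain w where w: "w \<in> carrier N" "\<And>j. f w j = F i0 j"
          using insert.prems(3) by meson
        have "\<exists>\<tau>\<in>carrier TP. \<forall>i j. tensor_eval e f \<tau> (i, j) = G i j"
        proof (rule insert.IH[of G a' b'])
          fix i j
          have "\<iota> (G i j) = \<iota> (F i j) - \<iota> (F i j0) / \<iota> (F i0 j0) * \<iota> (F i0 j)"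
            by (simp add: G_def emb_simps)
          also have "\<dots> = (\<Sum>s\<in>S. a' s i * b s j) - (\<Sum>s\<in>S. a' s i * b s j0) / \<iota> (F i0 j0) * \<iota> (F i0 j)"
            unfolding F'[of i j] F'[of i j0] using \<iota>j0 by (simp add: field_simps)
          also have "\<dots> = (\<Sum>s\<in>S. a' s i * b' s j)"
            by (simp add: b'_def right_diff_distrib sum_subtractf sum_distrib_right sum_divide_distrib mult.assoc)
          finally show "\<iota> (G i j) = (\<Sum>s\<in>S. a' s i * b' s j)" .
        next
          fix j
          obtain u where u: "u \<in> carrier M" "\<And>i. e u i = F i j"
            using insert.prems(2) by meson
          then show "\<exists>v\<in>carrier M. \<forall>i. e v i = G i j"
            using v by (intro bexI[of _ "u \<oplus>\<^bsub>M\<^esub> (- F i0 j / F i0 j0) \<odot>\<^bsub>M\<^esub> v"])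
              (simp_all add: M.closed M.e_simps G_def)
        next
          fix i
          obtain u where u: "u \<in> carrier N" "\<And>j. f u j = F i j"
            using insert.prems(3) by meson
          then show "\<exists>w\<in>carrier N. \<forall>j. f w j = G i j"
            using w by (intro bexI[of _ "u \<oplus>\<^bsub>N\<^esub> (- F i j0 / F i0 j0) \<odot>\<^bsub>N\<^esub> w"])
              (simp_all add: N.closed N.e_simps G_def)
        qed
        then obtain \<tau> where \<tau>: "\<tau> \<in> carrier TP" "\<And>i j. tensor_eval e f \<tau> (i, j) = G i j"
          by auto
        show ?thesis
          using \<tau> v w j0
          by (intro bexI[of _ "\<tau> \<oplus>\<^bsub>TP\<^esub> (1 / F i0 j0) \<odot>\<^bsub>TP\<^esub> pure_tensor M N v w"])
             (simp_all add: T.closed T.e_simps pure_closed eval_pure G_def)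
      qed
    qed
  qed
qed


section \<open>Bialgebras of functions on a monoid\<close>

text \<open>
  If the evaluations \<open>e x i\<close> determine \<open>x\<close> and the comultiplication dualises the addition of indices,
  every bialgebra axiom becomes an identity between functions on a product of index monoids.
\<close>

lemma (in tensor_coordinates) tensor_eq_pairI:
  assumes "U \<in> carrier TP" "V \<in> carrier TP"
    and "\<And>i j. tensor_eval e f U (i, j) = tensor_eval e f V (i, j)"
  shows "U = V"
  using assms by (intro tensor_eqI) auto

locale bialgebra_coordinates = algebra_coordinates A e
  for A :: "('k::field, 'a, 'm) bialgebra_scheme" and e :: "'a \<Rightarrow> 'i::comm_monoid_add \<Rightarrow> 'k" +
  assumes counit_eq: "x \<in> carrier A \<Longrightarrow> counit A x = e x 0"
    and comult_closed: "x \<in> carrier A \<Longrightarrow> comult A x \<in> carrier (tensor_product A A)"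
    and comult_eval: "x \<in> carrier A \<Longrightarrow> tensor_eval e e (comult A x) (i, j) = e x (i + j)"
begin

sublocale AA: tensor_algebra_coordinates A e A e ..
sublocale T: algebra_coordinates "tensor_product A A" "tensor_eval e e"
  by (rule AA.algebra_coordinates_tensor)
sublocale T_A: tensor_coordinates "tensor_product A A" "tensor_eval e e" A e ..
sublocale A_T: tensor_coordinates A e "tensor_product A A" "tensor_eval e e" ..

text \<open>After evaluation coassociativity compares e x ((i + j) + k) with e x (i + (j + k)), and
  the counit laws put 0 for one index.\<close>

lemma is_bialgebra: "bialgebra A"
proof -
  interpret alg: algebra scalars A by (rule is_algebra)
  note closed' = closed one_closed mult_closed
  note e' = e_simps e_one e_mult
  note Tclosed = T.closed T.one_closed T.mult_closed
  note Te = T.e_simps T.e_one T.e_mult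
  let ?R = "tensor_product A (tensor_product A A)"
  let ?L = "tensor_product (tensor_product A A) A"
  show ?thesis
  proof
    show "comult A \<in> algebra_hom A (tensor_product A A)"
      unfolding algebra_hom_def lin_hom_def
      by (intro IntI CollectI conjI ballI allI ring_hom_memI funcsetI AA.tensor_eq_pairI)
         (simp_all add: comult_closed closed' Tclosed comult_eval e' Te)
    show "counit A \<in> algebra_hom A scalar_algebra"
      unfolding algebra_hom_def lin_hom_def
      by (auto intro!: ring_hom_memI simp: scalar_algebra_eq counit_eq closed' e')
  next
    fix x assume x: "x \<in> carrier A"
    have "tensor_lift A (\<lambda>a b. counit A a \<odot>\<^bsub>A\<^esub> b) (comult A x) \<in> carrier A"
      using x by (intro AA.tensor_lift_e[OF coordinates_axioms] comult_closed closed)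
    moreover have "e (tensor_lift A (\<lambda>a b. counit A a \<odot>\<^bsub>A\<^esub> b) (comult A x)) i = e x i" for i
    proof -
      have "e (tensor_lift A (\<lambda>a b. counit A a \<odot>\<^bsub>A\<^esub> b) (comult A x)) i
          = lin_ext (\<lambda>p. e (counit A (fst p) \<odot>\<^bsub>A\<^esub> snd p) i) (tensor_rep (comult A x))"
        using x by (intro AA.tensor_lift_e[OF coordinates_axioms] comult_closed closed)
      also have "\<dots> = lin_ext (\<lambda>p. e (fst p) 0 * e (snd p) i) (tensor_rep (comult A x))"
        using x by (intro AA.lin_ext_rep_cong comult_closed) (simp_all add: e_simps counit_eq)
      finally show ?thesis
        using x by (simp add: AA.eval_rep' comult_eval)
    qed
    ultimately show "tensor_lift A (\<lambda>a b. counit A a \<odot>\<^bsub>A\<^esub> b) (comult A x) = x"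
      using x by (intro e_inject)
    have "tensor_lift A (\<lambda>a b. counit A b \<odot>\<^bsub>A\<^esub> a) (comult A x) \<in> carrier A"
      using x by (intro AA.tensor_lift_e[OF coordinates_axioms] comult_closed closed)
    moreover have "e (tensor_lift A (\<lambda>a b. counit A b \<odot>\<^bsub>A\<^esub> a) (comult A x)) i = e x i" for i
    proof -
      have "e (tensor_lift A (\<lambda>a b. counit A b \<odot>\<^bsub>A\<^esub> a) (comult A x)) i
          = lin_ext (\<lambda>p. e (counit A (snd p) \<odot>\<^bsub>A\<^esub> fst p) i) (tensor_rep (comult A x))"
        using x by (intro AA.tensor_lift_e[OF coordinates_axioms] comult_closed closed)
      also have "\<dots> = lin_ext (\<lambda>p. e (fst p) i * e (snd p) 0) (tensor_rep (comult A x))"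
        using x by (intro AA.lin_ext_rep_cong comult_closed) (simp_all add: e_simps counit_eq)
      finally show ?thesis
        using x by (simp add: AA.eval_rep' comult_eval)
    qed
    ultimately show "tensor_lift A (\<lambda>a b. counit A b \<odot>\<^bsub>A\<^esub> a) (comult A x) = x"
      using x by (intro e_inject)

    let ?r = "tensor_map A (tensor_product A A) id (comult A) (comult A x)"
    let ?l = "tensor_map (tensor_product A A) A (comult A) id (comult A x)"
    have r: "?r \<in> carrier ?R"
      unfolding tensor_map_def using x
      by (intro AA.tensor_lift_e[OF A_T.coordinates_tensor] comult_closed A_T.pure_closed) auto
    have l: "?l \<in> carrier ?L"
      unfolding tensor_map_def using x
      by (intro AA.tensor_lift_e[OF T_A.coordinates_tensor] comult_closed T_A.pure_closed) auto
    have r_eval: "tensor_eval e (tensor_eval e e) ?r (i, j, k) = e x (i + (j + k))" for i j k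
    proof -
      have "tensor_eval e (tensor_eval e e) ?r (i, j, k)
          = lin_ext (\<lambda>p. tensor_eval e (tensor_eval e e)
               (pure_tensor A (tensor_product A A) (id (fst p)) (comult A (snd p))) (i, j, k)) (tensor_rep (comult A x))"
        unfolding tensor_map_def using x
        by (intro AA.tensor_lift_e[OF A_T.coordinates_tensor] comult_closed A_T.pure_closed) auto
      also have "\<dots> = lin_ext (\<lambda>p. e (fst p) i * e (snd p) (j + k)) (tensor_rep (comult A x))"
        using x by (intro AA.lin_ext_rep_cong comult_closed) (simp_all add: A_T.eval_pure comult_eval)
      finally show ?thesis
        using x by (simp add: AA.eval_rep' comult_eval)
    qed
    have l_eval: "tensor_eval (tensor_eval e e) e ?l ((i, j), k) = e x ((i + j) + k)" for i j k
    proof -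
      have "tensor_eval (tensor_eval e e) e ?l ((i, j), k)
          = lin_ext (\<lambda>p. tensor_eval (tensor_eval e e) e
               (pure_tensor (tensor_product A A) A (comult A (fst p)) (id (snd p))) ((i, j), k)) (tensor_rep (comult A x))"
        unfolding tensor_map_def using x
        by (intro AA.tensor_lift_e[OF T_A.coordinates_tensor] comult_closed T_A.pure_closed) auto
      also have "\<dots> = lin_ext (\<lambda>p. e (fst p) (i + j) * e (snd p) k) (tensor_rep (comult A x))"
        using x by (intro AA.lin_ext_rep_cong comult_closed) (simp_all add: T_A.eval_pure comult_eval)
      finally show ?thesis
        using x by (simp add: AA.eval_rep' comult_eval)
    qed
    \<comment> \<open>The inner lift of \<open>tensor_assoc\<close> for a fixed last factor z; the
      outer lift runs over a representative of \<open>?l\<close>.\<close>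
    let ?\<beta> = "\<lambda>z x y. pure_tensor A (tensor_product A A) x (pure_tensor A A y z)"
    have \<beta>: "?\<beta> z x y \<in> carrier ?R" if "x \<in> carrier A" "y \<in> carrier A" "z \<in> carrier A" for x y z
      using that by (intro A_T.pure_closed AA.pure_closed)
    have inner: "tensor_lift ?R (?\<beta> z) U \<in> carrier ?R"
      if "U \<in> carrier (tensor_product A A)" "z \<in> carrier A" for U z
      using that by (intro AA.tensor_lift_e[OF A_T.coordinates_tensor] \<beta>)
    have inner_eval: "tensor_eval e (tensor_eval e e) (tensor_lift ?R (?\<beta> z) U) (i, j, k)
        = tensor_eval e e U (i, j) * e z k"
      if "U \<in> carrier (tensor_product A A)" "z \<in> carrier A" for U z i j k
    proof -
      have "tensor_eval e (tensor_eval e e) (tensor_lift ?R (?\<beta> z) U) (i, j, k)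
        = lin_ext (\<lambda>p. tensor_eval e (tensor_eval e e) (?\<beta> z (fst p) (snd p)) (i, j, k)) (tensor_rep U)"
        using that by (intro AA.tensor_lift_e[OF A_T.coordinates_tensor] \<beta>)
      also have "\<dots> = (\<Sum>p\<in>Poly_Mapping.keys (tensor_rep U).
          Poly_Mapping.lookup (tensor_rep U) p * (e (fst p) i * e (snd p) j) * e z k)"
        unfolding lin_ext_def
        by (intro sum.cong) (simp_all add: A_T.eval_pure AA.eval_pure mult.assoc)
      also have "\<dots> = tensor_eval e e U (i, j) * e z k"
        by (simp add: tensor_eval_def lin_ext_def sum_distrib_right)
      finally show ?thesis .
    qed
    have assoc: "tensor_assoc A A A ?l \<in> carrier ?R"
      unfolding tensor_assoc_def Let_def using l
      by (intro T_A.tensor_lift_e[OF A_T.coordinates_tensor] inner)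
    have assoc_eval: "tensor_eval e (tensor_eval e e) (tensor_assoc A A A ?l) (i, j, k) = e x ((i + j) + k)" for i j k
    proof -
      have "tensor_eval e (tensor_eval e e) (tensor_assoc A A A ?l) (i, j, k)
        = lin_ext (\<lambda>p. tensor_eval e (tensor_eval e e) (tensor_lift ?R (?\<beta> (snd p)) (fst p)) (i, j, k)) (tensor_rep ?l)"
        unfolding tensor_assoc_def Let_def using l
        by (intro T_A.tensor_lift_e[OF A_T.coordinates_tensor] inner)
      also have "\<dots> = lin_ext (\<lambda>p. tensor_eval e e (fst p) (i, j) * e (snd p) k) (tensor_rep ?l)"
        using l by (intro T_A.lin_ext_rep_cong) (simp_all add: inner_eval)
      also have "\<dots> = tensor_eval (tensor_eval e e) e ?l ((i, j), k)"
        by (simp add: tensor_eval_def)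
      finally show ?thesis by (simp add: l_eval)
    qed
    show "tensor_assoc A A A ?l = ?r"
      using assoc r
    proof (rule A_T.tensor_eqI)
      fix ijk show "tensor_eval e (tensor_eval e e) (tensor_assoc A A A ?l) ijk = tensor_eval e (tensor_eval e e) ?r ijk"
        by (cases ijk) (simp add: assoc_eval r_eval add.assoc)
    qed
  qed
qed

end

text \<open>The antipode reflects the index; evaluations determine its values, so linearity is
  automatic. Both antipode identities evaluate the comultiplication at opposite indices, which gives
  e x 0.\<close>

lemma hopf_algebra_of_coordinates:
  fixes A :: "('k::field, 'a, 'm) bialgebra_scheme" and e :: "'a \<Rightarrow> 'i::ab_group_add \<Rightarrow> 'k"
  assumes "bialgebra_coordinates A e"
    and "\<And>x. x \<in> carrier A \<Longrightarrow> \<exists>y\<in>carrier A. \<forall>i. e y i = e x (- i)"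
  shows "hopf_algebra A"
proof -
  interpret bialgebra_coordinates A e by fact
  interpret bialgebra A by (rule is_bialgebra)
  obtain S where S: "\<And>x. x \<in> carrier A \<Longrightarrow> S x \<in> carrier A" "\<And>x i. x \<in> carrier A \<Longrightarrow> e (S x) i = e x (- i)"
    using assms(2) by metis
  show ?thesis
  proof (unfold_locales, intro bexI[of _ S] ballI)
    show "S \<in> lin_hom A A"
      unfolding lin_hom_def by (auto intro!: e_inject simp: S closed e_simps)
  next
    fix x assume x: "x \<in> carrier A"
    let ?l = "tensor_lift A (\<lambda>a b. S a \<otimes>\<^bsub>A\<^esub> b) (comult A x)"
    let ?r = "tensor_lift A (\<lambda>a b. a \<otimes>\<^bsub>A\<^esub> S b) (comult A x)"
    have "?l \<in> carrier A"
      using x by (intro AA.tensor_lift_e[OF coordinates_axioms] comult_closed mult_closed S)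
    moreover have "?r \<in> carrier A"
      using x by (intro AA.tensor_lift_e[OF coordinates_axioms] comult_closed mult_closed S)
    moreover have "e ?l i = e x 0" for i
    proof -
      have "e ?l i = lin_ext (\<lambda>p. e (S (fst p) \<otimes>\<^bsub>A\<^esub> snd p) i) (tensor_rep (comult A x))"
        using x by (intro AA.tensor_lift_e[OF coordinates_axioms] comult_closed mult_closed S)
      also have "\<dots> = lin_ext (\<lambda>p. e (fst p) (- i) * e (snd p) i) (tensor_rep (comult A x))"
        using x by (intro AA.lin_ext_rep_cong comult_closed) (simp_all add: S e_mult)
      finally show ?thesis using x by (simp add: AA.eval_rep' comult_eval)
    qed
    moreover have "e ?r i = e x 0" for i
    proof -
      have "e ?r i = lin_ext (\<lambda>p. e (fst p \<otimes>\<^bsub>A\<^esub> S (snd p)) i) (tensor_rep (comult A x))"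
        using x by (intro AA.tensor_lift_e[OF coordinates_axioms] comult_closed mult_closed S)
      also have "\<dots> = lin_ext (\<lambda>p. e (fst p) i * e (snd p) (- i)) (tensor_rep (comult A x))"
        using x by (intro AA.lin_ext_rep_cong comult_closed) (simp_all add: S e_mult)
      finally show ?thesis using x by (simp add: AA.eval_rep' comult_eval)
    qed
    ultimately show "?l = counit A x \<odot>\<^bsub>A\<^esub> \<one>\<^bsub>A\<^esub> \<and> ?r = counit A x \<odot>\<^bsub>A\<^esub> \<one>\<^bsub>A\<^esub>"
      using x by (auto intro!: e_inject simp: closed one_closed e_simps e_one counit_eq)
  qed
qed

text \<open>Pulling functions back along a homomorphism \<phi> of index monoids respects the
  pointwise operations, and it respects counit and comultiplication because these use only 0 and +
  of the indices.\<close>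

lemma bialgebra_hom_of_coordinates:
  fixes A :: "('k::field, 'a, 'm) bialgebra_scheme" and e :: "'a \<Rightarrow> 'i::comm_monoid_add \<Rightarrow> 'k"
    and B :: "('k::field, 'b, 'n) bialgebra_scheme" and f :: "'b \<Rightarrow> 'j::comm_monoid_add \<Rightarrow> 'k"
  assumes "bialgebra_coordinates A e" "bialgebra_coordinates B f"
    and \<phi>: "\<phi> 0 = 0" "\<And>i j. \<phi> (i + j) = \<phi> i + \<phi> j"
    and h: "\<And>x. x \<in> carrier A \<Longrightarrow> h x \<in> carrier B" "\<And>x j. x \<in> carrier A \<Longrightarrow> f (h x) j = e x (\<phi> j)"
  shows "bialgebra_hom A B h"
proof -
  interpret A: bialgebra_coordinates A e by fact
  interpret B: bialgebra_coordinates B f by fact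
  interpret A': bialgebra A by (rule A.is_bialgebra)
  interpret B': bialgebra B by (rule B.is_bialgebra)
  note closed = A.closed A.one_closed A.mult_closed B.closed B.one_closed B.mult_closed
  note e = A.e_simps A.e_one A.e_mult B.e_simps B.e_one B.e_mult
  show ?thesis
  proof
    show "h \<in> algebra_hom A B"
      unfolding algebra_hom_def lin_hom_def
      by (auto intro!: ring_hom_memI B.e_inject simp: h closed e)
  next
    fix x assume x: "x \<in> carrier A"
    then show "counit B (h x) = counit A x"
      by (simp add: A.counit_eq B.counit_eq h \<phi>)
    have closed: "tensor_map B B h h (comult A x) \<in> carrier (tensor_product B B)"
      unfolding tensor_map_def using x
      by (intro A.AA.tensor_lift_e[OF B.AA.coordinates_tensor] A.comult_closed B.AA.pure_closed h)
    have eval: "tensor_eval f f (tensor_map B B h h (comult A x)) (i, j) = e x (\<phi> i + \<phi> j)" for i j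
    proof -
      have "tensor_eval f f (tensor_map B B h h (comult A x)) (i, j)
          = lin_ext (\<lambda>p. tensor_eval f f (pure_tensor B B (h (fst p)) (h (snd p))) (i, j)) (tensor_rep (comult A x))"
        unfolding tensor_map_def using x
        by (intro A.AA.tensor_lift_e[OF B.AA.coordinates_tensor] A.comult_closed B.AA.pure_closed h)
      also have "\<dots> = lin_ext (\<lambda>p. e (fst p) (\<phi> i) * e (snd p) (\<phi> j)) (tensor_rep (comult A x))"
        using x by (intro A.AA.lin_ext_rep_cong A.comult_closed) (simp_all add: B.AA.eval_pure h)
      finally show ?thesis using x by (simp add: A.AA.eval_rep' A.comult_eval)
    qed
    show "comult B (h x) = tensor_map B B h h (comult A x)"
    proof (rule B.AA.tensor_eqI)
      fix ij show "tensor_eval f f (comult B (h x)) ij = tensor_eval f f (tensor_map B B h h (comult A x)) ij"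
        using x by (cases ij) (simp add: eval B.comult_eval h \<phi>)
    qed (use x closed h B.comult_closed in auto)
  qed
qed


section \<open>Linear recursive sequences\<close>

lemma seq_functional_superset:
  assumes "Polynomial.degree p < n"
  shows "seq_functional f p = (\<Sum>i<n. Polynomial.coeff p i * f i)"
  unfolding seq_functional_def using assms
  by (intro sum.mono_neutral_left) (auto simp: coeff_eq_0)

lemma seq_functional_0 [simp]: "seq_functional f 0 = 0"
  by (simp add: seq_functional_def)

lemma seq_functional_add: "seq_functional f (p + q) = seq_functional f p + seq_functional f q"
proof -
  define n where "n = Suc (max (Polynomial.degree p) (Polynomial.degree q))"
  have "Polynomial.degree p < n" "Polynomial.degree q < n" "Polynomial.degree (p + q) < n"
    by (auto simp: n_def less_Suc_eq_le intro: degree_add_le_max)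
  then show ?thesis
    by (simp add: seq_functional_superset[where n = n] algebra_simps sum.distrib)
qed

lemma seq_functional_smult: "seq_functional f (Polynomial.smult c p) = c * seq_functional f p"
  by (cases "c = 0") (simp_all add: seq_functional_def sum_distrib_left mult.assoc)

lemma seq_functional_diff: "seq_functional f (p - q) = seq_functional f p - seq_functional f q"
  using seq_functional_add[of f "p - q" q] by simp

lemma seq_functional_sum: "seq_functional f (\<Sum>s\<in>S. p s) = (\<Sum>s\<in>S. seq_functional f (p s))"
  by (induction S rule: infinite_finite_induct) (simp_all add: seq_functional_add)

lemma seq_functional_monom [simp]: "seq_functional f (Polynomial.monom c n) = c * f n"
proof -
  have "seq_functional f (Polynomial.monom c n) = (\<Sum>i<Suc n. (if n = i then c else 0) * f i)"
    by (subst seq_functional_superset[where n = "Suc n"])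
       (auto simp: less_Suc_eq_le degree_monom_le)
  also have "\<dots> = (\<Sum>i<Suc n. if n = i then c * f i else 0)"
    by (intro sum.cong) auto
  finally show ?thesis by (simp del: sum.lessThan_Suc)
qed

lemma seq_functional_combination:
  "seq_functional (\<lambda>i. \<Sum>s\<in>S. c s * g s i) p = (\<Sum>s\<in>S. c s * seq_functional (g s) p)"
  unfolding seq_functional_def sum_distrib_left
  by (subst sum.swap) (simp add: mult.left_commute)

text \<open>Expanding both factors into monomials applies the functionals to the array f (i + j),
  one variable at a time. This is the duality between product and comultiplication in usable
  form.\<close>

lemma seq_functional_mult:
  "seq_functional f (p * q) = seq_functional (\<lambda>i. seq_functional (\<lambda>j. f (i + j)) q) p"
proof -
  have "p * q = (\<Sum>i\<le>Polynomial.degree p. \<Sum>j\<le>Polynomial.degree q.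
      Polynomial.monom (Polynomial.coeff p i * Polynomial.coeff q j) (i + j))"
    by (subst (1) poly_as_sum_of_monoms[symmetric], subst (2) poly_as_sum_of_monoms[symmetric])
       (simp add: sum_product mult_monom)
  then show ?thesis
    by (simp add: seq_functional_sum) (simp add: seq_functional_def sum_distrib_left mult.assoc)
qed

text \<open>Vanishing on the ideal of m can be tested on the multiples t^j m, that is, on the shifts
  of f; a nonzero m becomes monic by scaling.\<close>

lemma linear_recursive_iff:
  "f \<in> linear_recursive \<longleftrightarrow> (\<exists>m. m \<noteq> 0 \<and> (\<forall>j. seq_functional (\<lambda>i. f (i + j)) m = 0))"
proof
  assume "f \<in> linear_recursive"
  then obtain m where m: "Polynomial.lead_coeff m = 1" "\<And>p. seq_functional f (m * p) = 0"
    by (auto simp: linear_recursive_def)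
  have "seq_functional (\<lambda>i. f (i + j)) m = 0" for j
    using m(2)[of "Polynomial.monom 1 j"] by (simp add: seq_functional_mult)
  moreover have "m \<noteq> 0" using m(1) by auto
  ultimately show "\<exists>m. m \<noteq> 0 \<and> (\<forall>j. seq_functional (\<lambda>i. f (i + j)) m = 0)" by blast
next
  assume "\<exists>m. m \<noteq> 0 \<and> (\<forall>j. seq_functional (\<lambda>i. f (i + j)) m = 0)"
  then obtain m where m: "m \<noteq> 0" "\<And>j. seq_functional (\<lambda>i. f (i + j)) m = 0" by blast
  define m' where "m' = Polynomial.smult (inverse (Polynomial.lead_coeff m)) m"
  have "seq_functional f (m' * p) = 0" for p
  proof -
    have "seq_functional f (p * m') = seq_functional (\<lambda>j. seq_functional (\<lambda>i. f (j + i)) m') p"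
      by (rule seq_functional_mult)
    also have "\<dots> = 0"
      using m(2) by (simp add: m'_def seq_functional_smult add.commute[of _ "_::nat"])
        (simp add: seq_functional_def)
    finally show ?thesis by (simp add: mult.commute)
  qed
  moreover have "Polynomial.lead_coeff m' = 1"
    using m(1) by (simp add: m'_def)
  ultimately show "f \<in> linear_recursive"
    unfolding linear_recursive_def by blast
qed

text \<open>The bound N provides two polynomials of different degrees in the induction step, so that
  their combination killed by the new functional cannot vanish.\<close>

lemma ex_annihilating_poly:
  assumes "finite S"
  shows "\<exists>m. m \<noteq> 0 \<and> N \<le> Polynomial.degree m \<and> (\<forall>s\<in>S. seq_functional (w s) m = (0::'k::field))"
  using assms
proof (induction S arbitrary: N rule: finite_induct)
  case empty
  show ?case
    by (rule exI[of _ "Polynomial.monom 1 N"]) (simp add: degree_monom_eq monom_eq_0_iff)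
next
  case (insert t S)
  obtain p where p: "p \<noteq> 0" "N \<le> Polynomial.degree p" "\<And>s. s \<in> S \<Longrightarrow> seq_functional (w s) p = 0"
    using insert.IH by blast
  obtain q where q: "q \<noteq> 0" "Suc (Polynomial.degree p) \<le> Polynomial.degree q"
    "\<And>s. s \<in> S \<Longrightarrow> seq_functional (w s) q = 0"
    using insert.IH by blast
  show ?case
  proof (cases "seq_functional (w t) p = 0")
    case True
    then show ?thesis using p by blast
  next
    case False
    define r where "r = Polynomial.smult (seq_functional (w t) p) q - Polynomial.smult (seq_functional (w t) q) p"
    have c: "Polynomial.coeff r (Polynomial.degree q) = seq_functional (w t) p * Polynomial.lead_coeff q"
      using q(2) by (simp add: r_def coeff_eq_0)
    then have "Polynomial.coeff r (Polynomial.degree q) \<noteq> 0"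
      using False q(1) by simp
    then have "Polynomial.degree q \<le> Polynomial.degree r" "r \<noteq> 0"
      by (auto intro: le_degree)
    moreover have "\<forall>s\<in>insert t S. seq_functional (w s) r = 0"
      using p q by (auto simp: r_def seq_functional_diff seq_functional_smult)
    ultimately show ?thesis
      using p(2) q(2) by (intro exI[of _ r]) auto
  qed
qed

text \<open>A nonzero polynomial killed by the finitely many functionals w s kills every shift of
  f.\<close>

lemma linear_recursiveI:
  assumes "finite S" "\<And>i j. f (i + j) = (\<Sum>s\<in>S. v s i * w s j)"
  shows "f \<in> linear_recursive"
proof -
  obtain m where m: "m \<noteq> 0" "\<And>s. s \<in> S \<Longrightarrow> seq_functional (w s) m = 0"
    using ex_annihilating_poly[OF assms(1)] by blast
  have "seq_functional (\<lambda>i. f (i + j)) m = 0" for j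
    using m(2) assms(2)[of j] by (simp add: add.commute[of _ j] seq_functional_combination)
  then show ?thesis
    using m(1) linear_recursive_iff by blast
qed

text \<open>Reducing t^j modulo m expresses the j-th shift of f through the shifts below the degree
  of m; r k j is a coefficient of the remainder.\<close>

lemma linear_recursive_finite_rank:
  assumes "f \<in> linear_recursive"
  shows "\<exists>(d::nat) r. \<forall>i j. f (i + j) = (\<Sum>k<d. f (i + k) * r k j)"
proof -
  obtain m where m: "m \<noteq> 0" "\<And>j. seq_functional (\<lambda>i. f (i + j)) m = 0"
    using assms linear_recursive_iff by blast
  define r where "r k j = Polynomial.coeff (Polynomial.monom 1 j mod m) k" for k j
  have "f (i + j) = (\<Sum>k<Polynomial.degree m. f (i + k) * r k j)" for i j
  proof -
    let ?t = "Polynomial.monom 1 j"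
    let ?g = "\<lambda>k. f (i + k)"
    have "seq_functional (\<lambda>b. f (i + (a + b))) m = 0" for a
      using m(2)[of "i + a"] by (simp add: ac_simps)
    then have "seq_functional ?g (?t div m * m) = 0"
      by (simp add: seq_functional_mult) (simp add: seq_functional_def)
    moreover have "?t div m * m + ?t mod m = ?t" by simp
    ultimately have "seq_functional ?g ?t = seq_functional ?g (?t mod m)"
      by (metis seq_functional_add add_0)
    moreover have "seq_functional ?g (?t mod m) = (\<Sum>k<Polynomial.degree m. r k j * ?g k)"
    \<comment> \<open>The zero remainder is separate because m may be constant, and then no degree
      lies below that of m.\<close>
    proof (cases "?t mod m = 0")
      case False
      then show ?thesis
        using degree_mod_less[OF m(1), of ?t] by (simp add: seq_functional_superset r_def)
    qed (simp add: r_def)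
    ultimately show ?thesis
      by (simp add: mult.commute)
  qed
  then show ?thesis by blast
qed

lemma linear_recursive_shift: "f \<in> linear_recursive \<Longrightarrow> (\<lambda>i. f (i + j)) \<in> linear_recursive"
  by (auto simp: linear_recursive_iff add.assoc)

text \<open>The decompositions of the two Hankel arrays are put side by side, so ranks add; for
  Hadamard products they are multiplied termwise. A recurrence is then supplied by
  \<open>linear_recursiveI\<close>.\<close>

lemma linear_recursive_add:
  assumes "f \<in> linear_recursive" "g \<in> linear_recursive"
  shows "(\<lambda>n. f n + g n) \<in> linear_recursive"
proof -
  obtain d :: nat and r where f: "\<And>i j. f (i + j) = (\<Sum>k<d. f (i + k) * r k j)"
    using linear_recursive_finite_rank[OF assms(1)] by blast
  obtain d' :: nat and r' where g: "\<And>i j. g (i + j) = (\<Sum>k<d'. g (i + k) * r' k j)"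
    using linear_recursive_finite_rank[OF assms(2)] by blast
  show ?thesis
  proof (rule linear_recursiveI[where S = "{..<d} <+> {..<d'}"])
    show "f (i + j) + g (i + j) = (\<Sum>s\<in>{..<d} <+> {..<d'}.
        case_sum (\<lambda>k. f (i + k)) (\<lambda>k. g (i + k)) s * case_sum (\<lambda>k. r k j) (\<lambda>k. r' k j) s)" for i j
      by (simp add: sum.Plus f[of i j] g[of i j])
  qed simp
qed

lemma linear_recursive_mult:
  assumes "f \<in> linear_recursive" "g \<in> linear_recursive"
  shows "(\<lambda>n. f n * g n) \<in> linear_recursive"
proof -
  obtain d :: nat and r where f: "\<And>i j. f (i + j) = (\<Sum>k<d. f (i + k) * r k j)"
    using linear_recursive_finite_rank[OF assms(1)] by blast
  obtain d' :: nat and r' where g: "\<And>i j. g (i + j) = (\<Sum>k<d'. g (i + k) * r' k j)"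
    using linear_recursive_finite_rank[OF assms(2)] by blast
  show ?thesis
  proof (rule linear_recursiveI[where S = "{..<d} \<times> {..<d'}"])
    show "f (i + j) * g (i + j) = (\<Sum>s\<in>{..<d} \<times> {..<d'}.
        (f (i + fst s) * g (i + snd s)) * (r (fst s) j * r' (snd s) j))" for i j
      unfolding f[of i j] g[of i j] sum_product sum.cartesian_product case_prod_beta
      by (intro sum.cong) (simp_all add: ac_simps)
  qed simp
qed

lemma linear_recursive_const: "(\<lambda>n. c) \<in> linear_recursive"
  by (rule linear_recursiveI[where S = "{()}" and v = "\<lambda>_ _. c" and w = "\<lambda>_ _. 1"]) simp_all

lemma coordinates_linrec: "algebra_coordinates linrec_alg (\<lambda>f. f)"
  by unfold_locales
     (simp_all add: linrec_alg_def linear_recursive_add linear_recursive_mult linear_recursive_const fun_eq_iff)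


section \<open>Comultiplications given by a definite description\<close>

lemma module_extend_simps [simp]:
  "carrier (module.extend M u) = carrier M"
  "x \<otimes>\<^bsub>module.extend M u\<^esub> y = x \<otimes>\<^bsub>M\<^esub> y"
  "\<one>\<^bsub>module.extend M u\<^esub> = \<one>\<^bsub>M\<^esub>"
  "\<zero>\<^bsub>module.extend M u\<^esub> = \<zero>\<^bsub>M\<^esub>"
  "x \<oplus>\<^bsub>module.extend M u\<^esub> y = x \<oplus>\<^bsub>M\<^esub> y"
  "c \<odot>\<^bsub>module.extend M u\<^esub> y = c \<odot>\<^bsub>M\<^esub> y"
  by (simp_all add: module.defs)

lemma bialgebra_extend_simps [simp]:
  "comult (module.extend M (bialgebra.fields \<Delta> \<epsilon>)) = \<Delta>"
  "counit (module.extend M (bialgebra.fields \<Delta> \<epsilon>)) = \<epsilon>"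
  by (simp_all add: module.defs bialgebra.defs)

lemma tensor_product_extend [simp]:
  "tensor_product (module.extend M u) (module.extend N v) = tensor_product M N"
  unfolding tensor_product_def tensor_class_def tensor_relators_def pure_tensor_def by simp

text \<open>\<open>P\<close> stands for the condition inside the definite description. Once it is
  rewritten in evaluations, uniqueness is injectivity of evaluation, so existence is all that
  remains to be supplied.\<close>

lemma bialgebra_coordinates_extend:
  assumes "algebra_coordinates M e"
    and "\<And>x. x \<in> carrier M \<Longrightarrow> \<epsilon> x = e x 0"
    and ex: "\<And>x. x \<in> carrier M \<Longrightarrow> \<exists>\<tau>\<in>carrier (tensor_product M M). \<forall>i j. tensor_eval e e \<tau> (i, j) = e x (i + j)"
    and P: "\<And>x \<tau>. \<lbrakk>x \<in> carrier M; \<tau> \<in> carrier (tensor_product M M)\<rbrakk> \<Longrightarrow>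
      P x \<tau> \<longleftrightarrow> (\<forall>i j. tensor_eval e e \<tau> (i, j) = e x (i + j))"
  shows "bialgebra_coordinates (module.extend M (bialgebra.fields
    (\<lambda>x. THE \<tau>. \<tau> \<in> carrier (tensor_product M M) \<and> P x \<tau>) \<epsilon>)) e"
proof -
  interpret M: algebra_coordinates M e by fact
  interpret MM: tensor_coordinates M e M e ..
  have \<Delta>: "(THE \<tau>. \<tau> \<in> carrier (tensor_product M M) \<and> P x \<tau>) \<in> carrier (tensor_product M M) \<and>
      P x (THE \<tau>. \<tau> \<in> carrier (tensor_product M M) \<and> P x \<tau>)" if x: "x \<in> carrier M" for x
  proof (rule theI')
    show "\<exists>!\<tau>. \<tau> \<in> carrier (tensor_product M M) \<and> P x \<tau>"
      using ex[OF x] P[OF x] MM.tensor_eq_pairI by metis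
  qed
  then have "tensor_eval e e (THE \<tau>. \<tau> \<in> carrier (tensor_product M M) \<and> P x \<tau>) (i, j) = e x (i + j)"
    if "x \<in> carrier M" for x i j
    using P that by blast
  with \<Delta> assms(2) show ?thesis
    by unfold_locales
       (simp_all add: M.closed M.e_simps M.one_closed M.mult_closed M.e_one M.e_mult M.e_inject)
qed

lemma bialgebra_coordinates_linrec:
  "bialgebra_coordinates (linrec_bialgebra :: ('k::field, nat \<Rightarrow> 'k) bialgebra) (\<lambda>f. f)"
proof -
  interpret M: algebra_coordinates "linrec_alg :: ('k, nat \<Rightarrow> 'k) module" "\<lambda>f. f" by (rule coordinates_linrec)
  interpret MM: tensor_coordinates "linrec_alg :: ('k, nat \<Rightarrow> 'k) module" "\<lambda>f. f"
    "linrec_alg :: ('k, nat \<Rightarrow> 'k) module" "\<lambda>f. f" ..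
  show ?thesis
    unfolding linrec_bialgebra_def
  proof (rule bialgebra_coordinates_extend)
    show "algebra_coordinates linrec_alg (\<lambda>f. f)" by (rule coordinates_linrec)
  next
    fix f :: "nat \<Rightarrow> 'k" assume "f \<in> carrier linrec_alg"
    then have f: "f \<in> linear_recursive" by (simp add: linrec_alg_def)
    then obtain d :: nat and r where r: "\<And>i j. f (i + j) = (\<Sum>k<d. f (i + k) * r k j)"
      using linear_recursive_finite_rank by blast
    show "\<exists>\<tau>\<in>carrier MM.TP. \<forall>i j. tensor_eval (\<lambda>f. f) (\<lambda>f. f) \<tau> (i, j) = f (i + j)"
    \<comment> \<open>The rank is already finite over K, so the field extension is the
      identity.\<close>
    proof (rule MM.ex_tensor_of_finite_rank[where S = "{..<d}" and \<iota> = "\<lambda>x. x"])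
      show "field_embedding (\<lambda>x::'k. x)"
        by unfold_locales (auto intro!: ring_hom_memI)
      show "f (i + j) = (\<Sum>k<d. f (i + k) * r k j)" for i j by (rule r)
      show "\<exists>v\<in>carrier linrec_alg. \<forall>i. v i = f (i + j)" for j
        using linear_recursive_shift[OF f, of j]
        by (intro bexI[of _ "\<lambda>i. f (i + j)"]) (simp_all add: linrec_alg_def)
      show "\<exists>w\<in>carrier linrec_alg. \<forall>j. w j = f (i + j)" for i
        using linear_recursive_shift[OF f, of i]
        by (intro bexI[of _ "\<lambda>j. f (j + i)"]) (simp_all add: linrec_alg_def add.commute)
    qed simp
  next
    fix f :: "nat \<Rightarrow> 'k" and \<tau> assume \<tau>: "\<tau> \<in> carrier MM.TP"
    \<comment> \<open>The pairing with p \<otimes> q is the evaluation extended linearly in both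
      indices, so the condition for all p and q reduces to monomials.\<close>
    have lift: "tensor_lift scalar_algebra (\<lambda>g h. seq_functional g p * seq_functional h q) \<tau>
        = seq_functional (\<lambda>i. seq_functional (\<lambda>j. tensor_eval (\<lambda>f. f) (\<lambda>f. f) \<tau> (i, j)) q) p" for p q
    proof -
      have "tensor_lift scalar_algebra (\<lambda>g h. seq_functional g p * seq_functional h q) \<tau> =
        (\<Sum>x\<in>Poly_Mapping.keys (tensor_rep \<tau>). Poly_Mapping.lookup (tensor_rep \<tau>) x *
           seq_functional (snd x) q * seq_functional (fst x) p)"
        by (simp add: tensor_lift_scalar lin_ext_def mult.assoc mult.commute[of "seq_functional _ p"])
      also have "\<dots> = seq_functional (\<lambda>i. \<Sum>x\<in>Poly_Mapping.keys (tensor_rep \<tau>).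
          Poly_Mapping.lookup (tensor_rep \<tau>) x * seq_functional (snd x) q * fst x i) p"
        by (rule seq_functional_combination[symmetric])
      also have "\<dots> = seq_functional (\<lambda>i. \<Sum>x\<in>Poly_Mapping.keys (tensor_rep \<tau>).
          (Poly_Mapping.lookup (tensor_rep \<tau>) x * fst x i) * seq_functional (snd x) q) p"
        by (simp add: mult.assoc mult.commute mult.left_commute)
      also have "\<dots> = seq_functional (\<lambda>i. seq_functional (\<lambda>j. tensor_eval (\<lambda>f. f) (\<lambda>f. f) \<tau> (i, j)) q) p"
        by (simp only: seq_functional_combination[symmetric]) (simp add: tensor_eval_def lin_ext_def mult.assoc)
      finally show ?thesis .
    qed
    show "(\<forall>p q. tensor_lift scalar_algebra (\<lambda>g h. seq_functional g p * seq_functional h q) \<tau> =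
                 seq_functional f (p * q)) \<longleftrightarrow>
          (\<forall>i j. tensor_eval (\<lambda>f. f) (\<lambda>f. f) \<tau> (i, j) = f (i + j))" (is "?l \<longleftrightarrow> ?r")
    proof
      assume l: ?l
      have "tensor_eval (\<lambda>f. f) (\<lambda>f. f) \<tau> (i, j) = f (i + j)" for i j
        using lift[of "Polynomial.monom 1 i" "Polynomial.monom 1 j"]
          l[rule_format, of "Polynomial.monom 1 i" "Polynomial.monom 1 j"] by (simp add: mult_monom)
      then show ?r by blast
    next
      assume ?r
      then show ?l by (simp add: lift seq_functional_mult)
    qed
  qed simp
qed


section \<open>The fixed field of the Galois group\<close>

lemma poly_root_degree_pos:
  assumes "p \<noteq> 0" "poly p z = 0"
  shows "0 < Polynomial.degree p"
proof (rule ccontr)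
  assume "\<not> 0 < Polynomial.degree p"
  then obtain c where "p = [:c:]" by (auto elim: degree_eq_zeroE)
  with assms show False by simp
qed

text \<open>
  Homomorphisms over \<open>\<iota>\<close> from subrings into \<open>'c\<close> are handled as their graphs, so that extending them is
  enlarging a subset of \<open>'c \<times> 'c\<close>.
\<close>

locale algebraic_embedding = field_embedding \<iota> for \<iota> :: "'k::field \<Rightarrow> 'c::alg_closed_field" +
  assumes algebraic: "\<exists>p. p \<noteq> 0 \<and> poly (map_poly \<iota> p) x = 0"
begin

text \<open>Single-valuedness is demanded at 0 only; differences give it everywhere
  (\<open>ph_unique\<close>). Injectivity comes from algebraicity
  (\<open>ph_zero_iff\<close>).\<close>

definition partial_hom :: "('c \<times> 'c) set \<Rightarrow> bool" where
  "partial_hom \<Gamma> \<longleftrightarrow> (\<forall>k. (\<iota> k, \<iota> k) \<in> \<Gamma>) \<and>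
     (\<forall>x y x' y'. (x, x') \<in> \<Gamma> \<longrightarrow> (y, y') \<in> \<Gamma> \<longrightarrow> (x + y, x' + y') \<in> \<Gamma> \<and> (x * y, x' * y') \<in> \<Gamma>) \<and>
     (\<forall>y. (0, y) \<in> \<Gamma> \<longrightarrow> y = 0)"

text \<open>The action of the homomorphism on coefficients, kept as a relation because the
  homomorphism is a graph.\<close>

definition poly_rel :: "('c \<times> 'c) set \<Rightarrow> 'c poly \<Rightarrow> 'c poly \<Rightarrow> bool" where
  "poly_rel \<Gamma> p q \<longleftrightarrow> (\<forall>i. (Polynomial.coeff p i, Polynomial.coeff q i) \<in> \<Gamma>)"

section \<open>Division and polynomials along a partial homomorphism\<close>

context
  fixes \<Gamma> assumes \<Gamma>: "partial_hom \<Gamma>"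
begin

lemma ph_emb: "(\<iota> k, \<iota> k) \<in> \<Gamma>"
  and ph_add: "\<lbrakk>(x, x') \<in> \<Gamma>; (y, y') \<in> \<Gamma>\<rbrakk> \<Longrightarrow> (x + y, x' + y') \<in> \<Gamma>"
  and ph_mult: "\<lbrakk>(x, x') \<in> \<Gamma>; (y, y') \<in> \<Gamma>\<rbrakk> \<Longrightarrow> (x * y, x' * y') \<in> \<Gamma>"
  and ph_zeroD: "(0, y) \<in> \<Gamma> \<Longrightarrow> y = 0"
  using \<Gamma> unfolding partial_hom_def by blast+

lemma ph_zero: "(0, 0) \<in> \<Gamma>" and ph_one: "(1, 1) \<in> \<Gamma>"
  using ph_emb[of 0] ph_emb[of 1] by (simp_all add: emb_zero emb_one)

lemma ph_minus: "(x, x') \<in> \<Gamma> \<Longrightarrow> (- x, - x') \<in> \<Gamma>"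
  using ph_mult[OF ph_emb[of "- 1"], of x x'] by (simp add: emb_simps)

lemma ph_diff: "\<lbrakk>(x, x') \<in> \<Gamma>; (y, y') \<in> \<Gamma>\<rbrakk> \<Longrightarrow> (x - y, x' - y') \<in> \<Gamma>"
  using ph_add[OF _ ph_minus, of x x' y y'] by simp

lemma ph_unique: "\<lbrakk>(x, y) \<in> \<Gamma>; (x, y') \<in> \<Gamma>\<rbrakk> \<Longrightarrow> y = y'"
  using ph_diff[of x y x y'] ph_zeroD[of "y - y'"] by simp

lemma ph_sum: "(\<And>i. i \<in> I \<Longrightarrow> (f i, g i) \<in> \<Gamma>) \<Longrightarrow> ((\<Sum>i\<in>I. f i), (\<Sum>i\<in>I. g i)) \<in> \<Gamma>"
  by (induction I rule: infinite_finite_induct) (simp_all add: ph_zero ph_add)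

lemma ph_poly: "(x, x') \<in> \<Gamma> \<Longrightarrow> (poly (map_poly \<iota> p) x, poly (map_poly \<iota> p) x') \<in> \<Gamma>"
  by (induction p) (simp_all add: map_poly_pCons emb_zero ph_zero ph_add ph_mult ph_emb)

text \<open>Over K the inverse of a nonzero algebraic x is a polynomial in x, and the same
  polynomial inverts x'.\<close>

lemma ph_inverse:
  assumes "(x, x') \<in> \<Gamma>" "x \<noteq> 0"
  shows "(inverse x, inverse x') \<in> \<Gamma>" "x' \<noteq> 0"
proof -
  \<comment> \<open>Stripping factors of the variable from an annihilating polynomial of x leaves a
    nonzero constant term.\<close>
  have "\<exists>a q. a \<noteq> 0 \<and> \<iota> a + x * poly (map_poly \<iota> q) x = 0"
    if "p \<noteq> 0" "poly (map_poly \<iota> p) x = 0" for p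
    using that
  proof (induction p)
    case (pCons a q)
    show ?case
    proof (cases "a = 0")
      case True
      then show ?thesis
        using pCons assms(2) by (auto simp: map_poly_pCons emb_zero)
    next
      case False
      then show ?thesis
        using pCons by (auto simp: map_poly_pCons emb_zero)
    qed
  qed simp
  then obtain a q where aq: "a \<noteq> 0" "\<iota> a + x * poly (map_poly \<iota> q) x = 0"
    using algebraic by blast
  have "(\<iota> a + x * poly (map_poly \<iota> q) x, \<iota> a + x' * poly (map_poly \<iota> q) x') \<in> \<Gamma>"
    using assms(1) by (intro ph_add ph_mult ph_emb ph_poly)
  then have aq': "\<iota> a + x' * poly (map_poly \<iota> q) x' = 0"
    using aq(2) ph_zeroD by simp
  have a: "\<iota> a \<noteq> 0" using aq(1) by (simp add: emb_eq_0_iff)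
  then show x': "x' \<noteq> 0" using aq' by auto
  have inv: "inverse u = \<iota> (inverse (- a)) * poly (map_poly \<iota> q) u"
    if "\<iota> a + u * poly (map_poly \<iota> q) u = 0" "u \<noteq> 0" for u
  proof -
    have "u * poly (map_poly \<iota> q) u = \<iota> (- a)"
      using that(1) by (simp add: emb_minus add_eq_0_iff)
    then have "poly (map_poly \<iota> q) u = - \<iota> a / u"
      using that(2) by (metis emb_minus nonzero_mult_div_cancel_left)
    then show ?thesis
      using a by (simp add: emb_inverse emb_minus divide_inverse)
  qed
  show "(inverse x, inverse x') \<in> \<Gamma>"
    unfolding inv[OF aq(2) assms(2)] inv[OF aq' x']
    using assms(1) by (intro ph_mult ph_emb ph_poly)
qed

lemma ph_zero_iff: "(x, x') \<in> \<Gamma> \<Longrightarrow> x = 0 \<longleftrightarrow> x' = 0"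
  using ph_inverse(2) ph_zeroD by blast

lemma ph_divide:
  assumes "(x, x') \<in> \<Gamma>" "(y, y') \<in> \<Gamma>"
  shows "(x / y, x' / y') \<in> \<Gamma>"
proof -
  have "(inverse y, inverse y') \<in> \<Gamma>"
    using assms(2) ph_inverse(1) ph_zeroD[of y'] ph_zero by (cases "y = 0") auto
  then show ?thesis
    unfolding divide_inverse using assms(1) by (intro ph_mult)
qed

lemma pr_coeff: "poly_rel \<Gamma> p p' \<Longrightarrow> (Polynomial.coeff p i, Polynomial.coeff p' i) \<in> \<Gamma>"
  by (simp add: poly_rel_def)

lemma pr_add: "\<lbrakk>poly_rel \<Gamma> p p'; poly_rel \<Gamma> q q'\<rbrakk> \<Longrightarrow> poly_rel \<Gamma> (p + q) (p' + q')"
  and pr_diff: "\<lbrakk>poly_rel \<Gamma> p p'; poly_rel \<Gamma> q q'\<rbrakk> \<Longrightarrow> poly_rel \<Gamma> (p - q) (p' - q')"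
  and pr_mult: "\<lbrakk>poly_rel \<Gamma> p p'; poly_rel \<Gamma> q q'\<rbrakk> \<Longrightarrow> poly_rel \<Gamma> (p * q) (p' * q')"
  by (auto simp: poly_rel_def coeff_mult intro!: ph_add ph_diff ph_sum ph_mult)

lemma pr_monom: "(c, c') \<in> \<Gamma> \<Longrightarrow> poly_rel \<Gamma> (Polynomial.monom c n) (Polynomial.monom c' n)"
  by (auto simp: poly_rel_def ph_zero)

lemma pr_emb: "poly_rel \<Gamma> (map_poly \<iota> p) (map_poly \<iota> p)"
  by (auto simp: poly_rel_def coeff_map_poly emb_zero ph_emb)

lemma pr_degree: "poly_rel \<Gamma> p p' \<Longrightarrow> Polynomial.degree p = Polynomial.degree p'"
  and pr_zero_iff: "poly_rel \<Gamma> p p' \<Longrightarrow> p = 0 \<longleftrightarrow> p' = 0"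
proof -
  assume p: "poly_rel \<Gamma> p p'"
  have *: "Polynomial.coeff p i = 0 \<longleftrightarrow> Polynomial.coeff p' i = 0" for i
    using pr_coeff[OF p] by (rule ph_zero_iff)
  then show "Polynomial.degree p = Polynomial.degree p'"
    unfolding Polynomial.degree_def by simp
  show "p = 0 \<longleftrightarrow> p' = 0"
    using * by (simp add: poly_eq_iff)
qed

text \<open>Division with remainder by a polynomial of least degree vanishing at \<open>z\<close>, done on both sides at once.\<close>

lemma pr_root_transfer:
  assumes p: "poly_rel \<Gamma> p p'" "p \<noteq> 0" "poly p z = 0" "poly p' w = 0"
    and min: "\<And>q q'. \<lbrakk>poly_rel \<Gamma> q q'; q \<noteq> 0; poly q z = 0\<rbrakk> \<Longrightarrow> Polynomial.degree p \<le> Polynomial.degree q"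
    and q: "poly_rel \<Gamma> q q'" "poly q z = 0"
  shows "poly q' w = 0"
  using q
proof (induction "Polynomial.degree q" arbitrary: q q' rule: less_induct)
  case less
  show ?case
  proof (cases "q = 0")
    case True
    then show ?thesis using pr_zero_iff[OF less.prems(1)] by simp
  next
    case False
    have le: "Polynomial.degree p \<le> Polynomial.degree q"
      using min[OF less.prems(1) False less.prems(2)] .
    define n where "n = Polynomial.degree q - Polynomial.degree p"
    define c where "c = Polynomial.lead_coeff q / Polynomial.lead_coeff p"
    \<comment> \<open>Coefficients of q' and p' are taken at the degrees of q and p, so that c' is
      visibly the partner of c.\<close>
    define c' where "c' = Polynomial.coeff q' (Polynomial.degree q) / Polynomial.coeff p' (Polynomial.degree p)"
    define r where "r = q - Polynomial.monom c n * p"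
    define r' where "r' = q' - Polynomial.monom c' n * p'"
    have cc: "(c, c') \<in> \<Gamma>"
      unfolding c_def c'_def using less.prems(1) p(1) by (intro ph_divide pr_coeff)
    have r: "poly_rel \<Gamma> r r'"
      unfolding r_def r'_def using less.prems(1) p(1) cc by (intro pr_diff pr_mult pr_monom)
    have rz: "poly r z = 0"
      using less.prems(2) p(3) by (simp add: r_def)
    have top: "Polynomial.coeff r (Polynomial.degree q) = 0"
      using le p(2) by (simp add: r_def coeff_monom_mult n_def c_def)
    have "Polynomial.degree (Polynomial.monom c n * p) \<le> Polynomial.degree q"
      using degree_mult_le[of "Polynomial.monom c n" p] degree_monom_le[of c n] le by (simp add: n_def)
    then have "Polynomial.degree r \<le> Polynomial.degree q"
      unfolding r_def by (intro degree_diff_le) auto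
    then have "r = 0 \<or> Polynomial.degree r < Polynomial.degree q"
      using top by (metis le_neq_implies_less leading_coeff_0_iff)
    then have "poly r' w = 0"
      using less.hyps[OF _ r rz] pr_zero_iff[OF r] by auto
    then show ?thesis
      using p(4) by (simp add: r'_def)
  qed
qed

text \<open>Polynomial expressions in z are sent to the same expressions in w with transported
  coefficients. This is well defined because a relation q(z) = 0 transfers to w.\<close>

lemma ph_extend:
  assumes p: "poly_rel \<Gamma> p p'" "p \<noteq> 0" "poly p z = 0" "poly p' w = 0"
    and min: "\<And>q q'. \<lbrakk>poly_rel \<Gamma> q q'; q \<noteq> 0; poly q z = 0\<rbrakk> \<Longrightarrow> Polynomial.degree p \<le> Polynomial.degree q"
  shows "\<exists>\<Gamma>'. partial_hom \<Gamma>' \<and> \<Gamma> \<subseteq> \<Gamma>' \<and> (z, w) \<in> \<Gamma>'"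
proof -
  define \<Gamma>' where "\<Gamma>' = {(poly q z, poly q' w) | q q'. poly_rel \<Gamma> q q'}"
  have mem: "(poly q z, poly q' w) \<in> \<Gamma>'" if "poly_rel \<Gamma> q q'" for q q'
    using that by (auto simp: \<Gamma>'_def)
  have sub: "\<Gamma> \<subseteq> \<Gamma>'"
  proof safe
    fix x x' assume "(x, x') \<in> \<Gamma>"
    then show "(x, x') \<in> \<Gamma>'"
      using mem[OF pr_monom, of x x' 0] by (simp add: poly_monom)
  qed
  have "partial_hom \<Gamma>'"
    unfolding partial_hom_def
  proof (intro conjI allI impI)
    fix k show "(\<iota> k, \<iota> k) \<in> \<Gamma>'" using ph_emb sub by blast
  next
    fix x y x' y' assume "(x, x') \<in> \<Gamma>'" "(y, y') \<in> \<Gamma>'"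
    then obtain q q' r r' where qr: "poly_rel \<Gamma> q q'" "poly_rel \<Gamma> r r'"
      "x = poly q z" "x' = poly q' w" "y = poly r z" "y' = poly r' w"
      by (auto simp: \<Gamma>'_def)
    show "(x + y, x' + y') \<in> \<Gamma>'" "(x * y, x' * y') \<in> \<Gamma>'"
      using mem[OF pr_add[OF qr(1,2)]] mem[OF pr_mult[OF qr(1,2)]] by (simp_all add: qr)
  next
    fix y assume "(0, y) \<in> \<Gamma>'"
    then obtain q q' where q: "poly_rel \<Gamma> q q'" "poly q z = 0" "y = poly q' w"
      unfolding \<Gamma>'_def by auto
    have "poly q' w = 0"
      by (rule pr_root_transfer[OF p _ q(1,2)]) (rule min)
    then show "y = 0" by (simp add: q)
  qed
  moreover have "(z, w) \<in> \<Gamma>'"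
    using mem[OF pr_monom[OF ph_one], of 1] by (simp add: poly_monom)
  ultimately show ?thesis using sub by blast
qed

text \<open>Least degree takes the place of irreducibility, since it is what division with remainder
  consumes.\<close>

lemma ex_minimal_poly:
  obtains p p' where "poly_rel \<Gamma> p p'" "p \<noteq> 0" "poly p z = 0"
    "\<And>q q'. \<lbrakk>poly_rel \<Gamma> q q'; q \<noteq> 0; poly q z = 0\<rbrakk> \<Longrightarrow> Polynomial.degree p \<le> Polynomial.degree q"
proof -
  obtain p where "p \<noteq> 0" "poly (map_poly \<iota> p) z = 0"
    using algebraic by blast
  moreover from this have "map_poly \<iota> p \<noteq> 0"
    by (simp add: map_poly_eq_0_iff emb_zero emb_eq_0_iff)
  ultimately have "poly_rel \<Gamma> (fst u) (snd u) \<and> fst u \<noteq> 0 \<and> poly (fst u) z = 0"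
    if "u = (map_poly \<iota> p, map_poly \<iota> p)" for u
    using pr_emb that by auto
  from ex_has_least_nat[where P = "\<lambda>u. poly_rel \<Gamma> (fst u) (snd u) \<and> fst u \<noteq> 0 \<and> poly (fst u) z = 0",
      OF this[OF refl], of "\<lambda>u. Polynomial.degree (fst u)"]
  obtain u where "poly_rel \<Gamma> (fst u) (snd u) \<and> fst u \<noteq> 0 \<and> poly (fst u) z = 0"
    "\<And>v. poly_rel \<Gamma> (fst v) (snd v) \<and> fst v \<noteq> 0 \<and> poly (fst v) z = 0 \<Longrightarrow>
       Polynomial.degree (fst u) \<le> Polynomial.degree (fst v)"
    by blast
  then show thesis by (intro that[of "fst u" "snd u"]) auto
qed

lemma ph_extend_domain: "\<exists>\<Gamma>' w. partial_hom \<Gamma>' \<and> \<Gamma> \<subseteq> \<Gamma>' \<and> (z, w) \<in> \<Gamma>'"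
proof -
  obtain p p' where p: "poly_rel \<Gamma> p p'" "p \<noteq> 0" "poly p z = 0"
    "\<And>q q'. \<lbrakk>poly_rel \<Gamma> q q'; q \<noteq> 0; poly q z = 0\<rbrakk> \<Longrightarrow> Polynomial.degree p \<le> Polynomial.degree q"
    using ex_minimal_poly by blast
  have "0 < Polynomial.degree p"
    using poly_root_degree_pos p(2,3) by blast
  then have "\<exists>w. poly p' w = 0"
    using pr_degree[OF p(1)] by (intro alg_closed_imp_poly_has_root) simp
  then obtain w where w: "poly p' w = 0" ..
  have "\<exists>\<Gamma>'. partial_hom \<Gamma>' \<and> \<Gamma> \<subseteq> \<Gamma>' \<and> (z, w) \<in> \<Gamma>'"
    by (rule ph_extend[OF p(1-3) w]) (rule p(4))
  then show ?thesis by blast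
qed

end

section \<open>From partial homomorphisms to automorphisms\<close>

lemma partial_hom_Union:
  assumes "C \<noteq> {}" "\<And>\<Gamma>. \<Gamma> \<in> C \<Longrightarrow> partial_hom \<Gamma>"
    and chain: "\<And>\<Gamma> \<Gamma>'. \<lbrakk>\<Gamma> \<in> C; \<Gamma>' \<in> C\<rbrakk> \<Longrightarrow> \<Gamma> \<subseteq> \<Gamma>' \<or> \<Gamma>' \<subseteq> \<Gamma>"
  shows "partial_hom (\<Union>C)"
  unfolding partial_hom_def
proof (intro conjI allI impI)
  fix k show "(\<iota> k, \<iota> k) \<in> \<Union>C" using assms(1,2) ph_emb by blast
next
  fix x y x' y' assume "(x, x') \<in> \<Union>C" "(y, y') \<in> \<Union>C"
  then obtain \<Gamma> where "\<Gamma> \<in> C" "(x, x') \<in> \<Gamma>" "(y, y') \<in> \<Gamma>"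
    using chain by blast
  then show "(x + y, x' + y') \<in> \<Union>C" "(x * y, x' * y') \<in> \<Union>C"
    using assms(2) ph_add ph_mult by blast+
next
  fix y assume "(0, y) \<in> \<Union>C"
  then show "y = 0" using assms(2) ph_zeroD by blast
qed

text \<open>A maximal graph is total, because any element can be adjoined. The resulting
  endomorphism is onto because it injects the finite root set of each polynomial over K into
  itself.\<close>

lemma extend_to_galois:
  assumes "partial_hom \<Gamma>0"
  shows "\<exists>\<sigma>\<in>galois_group \<iota>. \<forall>x y. (x, y) \<in> \<Gamma>0 \<longrightarrow> \<sigma> x = y"
proof -
  let ?A = "{\<Gamma>. partial_hom \<Gamma> \<and> \<Gamma>0 \<subseteq> \<Gamma>}"
  have "\<exists>\<Gamma>\<in>?A. \<forall>\<Gamma>'\<in>?A. \<Gamma> \<subseteq> \<Gamma>' \<longrightarrow> \<Gamma>' = \<Gamma>"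
  proof (rule subset_Zorn_nonempty)
    show "?A \<noteq> {}" using assms by blast
    fix C assume C: "C \<noteq> {}" "subset.chain ?A C"
    then have "partial_hom (\<Union>C)"
      by (intro partial_hom_Union) (fastforce simp: subset_chain_def)+
    then show "\<Union>C \<in> ?A"
      using C unfolding subset_chain_def by blast
  qed
  then obtain \<Gamma> where "\<Gamma> \<in> ?A" and max': "\<forall>\<Gamma>'\<in>?A. \<Gamma> \<subseteq> \<Gamma>' \<longrightarrow> \<Gamma>' = \<Gamma>"
    by (rule bexE)
  then have \<Gamma>: "partial_hom \<Gamma>" "\<Gamma>0 \<subseteq> \<Gamma>" by simp_all
  have max: "\<Gamma>' = \<Gamma>" if "partial_hom \<Gamma>'" "\<Gamma> \<subseteq> \<Gamma>'" for \<Gamma>'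
    using max' \<Gamma>(2) that by simp
  have total: "\<exists>w. (z, w) \<in> \<Gamma>" for z
    using ph_extend_domain[OF \<Gamma>(1), of z] max by blast
  then obtain \<sigma> where \<sigma>: "\<And>z. (z, \<sigma> z) \<in> \<Gamma>" by metis
  have \<sigma>_eq: "\<sigma> x = y" if "(x, y) \<in> \<Gamma>" for x y
    using ph_unique[OF \<Gamma>(1) \<sigma> that] .
  have hom: "\<sigma> (x + y) = \<sigma> x + \<sigma> y" "\<sigma> (x * y) = \<sigma> x * \<sigma> y" "\<sigma> (\<iota> k) = \<iota> k" "\<sigma> 1 = 1" for x y k
    by (rule \<sigma>_eq, rule ph_add[OF \<Gamma>(1) \<sigma> \<sigma>] ph_mult[OF \<Gamma>(1) \<sigma> \<sigma>] ph_emb[OF \<Gamma>(1)] ph_one[OF \<Gamma>(1)])+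
  have inj: "inj \<sigma>"
  proof (rule injI)
    fix x y assume "\<sigma> x = \<sigma> y"
    then have "(x - y, 0) \<in> \<Gamma>"
      using ph_diff[OF \<Gamma>(1) \<sigma> \<sigma>, of x y] by simp
    then show "x = y" using ph_zero_iff[OF \<Gamma>(1), of "x - y" 0] by simp
  qed
  have "surj \<sigma>"
  proof -
    have "\<exists>x. y = \<sigma> x" for y
    proof -
      obtain p where p: "p \<noteq> 0" "poly (map_poly \<iota> p) y = 0"
        using algebraic by blast
      let ?R = "{x. poly (map_poly \<iota> p) x = 0}"
      have "finite ?R"
        using p(1) by (intro poly_roots_finite) (simp add: map_poly_eq_0_iff emb_zero emb_eq_0_iff)
      moreover have "\<sigma> ` ?R \<subseteq> ?R"
      proof safe
        fix x assume "poly (map_poly \<iota> p) x = 0"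
        with ph_poly[OF \<Gamma>(1) \<sigma>, of p x] have "(0, poly (map_poly \<iota> p) (\<sigma> x)) \<in> \<Gamma>" by simp
        then show "poly (map_poly \<iota> p) (\<sigma> x) = 0" by (rule ph_zeroD[OF \<Gamma>(1)])
      qed
      ultimately have "\<sigma> ` ?R = ?R"
        using inj by (intro endo_inj_surj) (auto intro: inj_on_subset)
      with p(2) show ?thesis by blast
    qed
    then show ?thesis by (auto simp: surj_def)
  qed
  then have "\<sigma> \<in> galois_group \<iota>"
    using inj by (simp add: galois_group_def ring_iso_def bij_def hom ring_hom_memI)
  with \<Gamma>(2) \<sigma>_eq show ?thesis by blast
qed

lemma partial_hom_base: "partial_hom {(\<iota> k, \<iota> k) | k. True}"
  unfolding partial_hom_def
  by (auto simp: emb_add[symmetric] emb_mult[symmetric] emb_eq_0_iff[THEN iffD1, OF sym])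

lemma fixed_field:
  assumes char: "CHAR('k) = 0" and fixed: "\<And>\<sigma>. \<sigma> \<in> galois_group \<iota> \<Longrightarrow> \<sigma> z = z"
  shows "z \<in> range \<iota>"
proof -
  let ?\<Gamma> = "{(\<iota> k, \<iota> k) | k. True}"
  note \<Gamma> = partial_hom_base
  obtain p p' where p: "poly_rel ?\<Gamma> p p'" "p \<noteq> 0" "poly p z = 0"
    "\<And>q q'. \<lbrakk>poly_rel ?\<Gamma> q q'; q \<noteq> 0; poly q z = 0\<rbrakk> \<Longrightarrow> Polynomial.degree p \<le> Polynomial.degree q"
    using ex_minimal_poly[OF \<Gamma>] by blast
  \<comment> \<open>Over the identity graph a polynomial is related only to itself, so every root of
    p is an admissible image of z.\<close>
  have p': "p' = p"
  proof (rule poly_eqI)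
    fix n
    have "(Polynomial.coeff p n, Polynomial.coeff p' n) \<in> ?\<Gamma>"
      using p(1) by (simp only: poly_rel_def)
    then show "Polynomial.coeff p' n = Polynomial.coeff p n" by auto
  qed
  have coeffs: "Polynomial.coeff p i \<in> range \<iota>" for i
    using p(1) by (auto simp: poly_rel_def)
  have only_root: "w = z" if "poly p w = 0" for w
  proof -
    have "\<exists>\<Gamma>'. partial_hom \<Gamma>' \<and> ?\<Gamma> \<subseteq> \<Gamma>' \<and> (z, w) \<in> \<Gamma>'"
      by (rule ph_extend[OF \<Gamma> p(1-3)]) (simp add: p' that, rule p(4))
    then obtain \<Gamma>' where \<Gamma>': "partial_hom \<Gamma>'" "(z, w) \<in> \<Gamma>'"
      by blast
    obtain \<sigma> where "\<sigma> \<in> galois_group \<iota>" "\<sigma> z = w"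
      using extend_to_galois[OF \<Gamma>'(1)] \<Gamma>'(2) by blast
    then show ?thesis using fixed by metis
  qed
  have deg: "0 < Polynomial.degree p"
    using poly_root_degree_pos p(2,3) by blast
  obtain q where q: "p = [:- z, 1:] * q"
    using p(3) by (auto simp: poly_eq_0_iff_dvd)
  \<comment> \<open>A double root would make the derivative, nonzero in characteristic zero, an
    annihilator of z of smaller degree.\<close>
  have "poly q z \<noteq> 0"
  proof
    assume "poly q z = 0"
    then have "poly (pderiv p) z = 0"
      unfolding q pderiv_mult by simp
    moreover have "poly_rel ?\<Gamma> (pderiv p) (pderiv p)"
      unfolding poly_rel_def
    proof
      fix i
      obtain k where "Polynomial.coeff p (Suc i) = \<iota> k" using coeffs by blast
      then have "Polynomial.coeff (pderiv p) i = \<iota> (of_nat (Suc i) * k)"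
        by (simp add: coeff_pderiv emb_simps)
      then show "(Polynomial.coeff (pderiv p) i, Polynomial.coeff (pderiv p) i) \<in> ?\<Gamma>"
        by blast
    qed
    moreover have "pderiv p \<noteq> 0"
    proof -
      have "(of_nat (Polynomial.degree p) :: 'k) \<noteq> 0"
        using deg char by (simp add: of_nat_eq_0_iff_char_dvd)
      then have "(of_nat (Polynomial.degree p) :: 'c) \<noteq> 0"
        using emb_eq_0_iff[of "of_nat (Polynomial.degree p)"] by (simp add: emb_of_nat)
      then have "Polynomial.coeff (pderiv p) (Polynomial.degree p - 1) \<noteq> 0"
        using deg p(2) by (simp add: coeff_pderiv)
      then show ?thesis by auto
    qed
    ultimately have "Polynomial.degree p \<le> Polynomial.degree (pderiv p)"
      by (intro p(4))
    also have "\<dots> < Polynomial.degree p"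
    proof -
      have "Polynomial.degree (pderiv p) \<le> Polynomial.degree p - 1"
        by (rule degree_le) (auto simp: coeff_pderiv coeff_eq_0)
      then show ?thesis using deg by linarith
    qed
    finally show False by simp
  qed
  moreover have "w = z" if "poly q w = 0" for w
    using that by (intro only_root) (simp only: q poly_mult mult_zero_right)
  \<comment> \<open>A root of the cofactor q is a root of p, hence z, which was excluded. So q is
    constant and p is linear.\<close>
  ultimately have "\<not> (\<exists>w. poly q w = 0)"
    by blast
  then have "Polynomial.degree q = 0"
    using alg_closed_imp_poly_has_root[of q] by blast
  then obtain c where c: "q = [:c:]"
    by (rule degree_eq_zeroE)
  obtain a b where ab: "Polynomial.coeff p 0 = \<iota> a" "Polynomial.coeff p 1 = \<iota> b"
    using coeffs by blast
  have "c \<noteq> 0" using p(2) by (auto simp: q c)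
  moreover have "\<iota> a = - (z * c)" "\<iota> b = c"
    using ab[symmetric] by (simp_all only: q c) simp_all
  ultimately have "z = \<iota> (- a / b)"
    by (simp add: emb_simps)
  then show ?thesis by blast
qed

end


section \<open>The invariants of the group algebra\<close>

text \<open>The Vandermonde argument in Lagrange form: a polynomial vanishing at all other keys
  isolates the coefficient of s.\<close>

lemma lin_ext_powers_eq_0:
  assumes "\<And>n. lin_ext (\<lambda>s. s ^ n) z = (0::'c::field)"
  shows "z = 0"
proof (rule ccontr)
  assume "z \<noteq> 0"
  then obtain s where s: "s \<in> Poly_Mapping.keys z"
    by (metis keys_eq_empty ex_in_conv)
  define p where "p = (\<Prod>t\<in>Poly_Mapping.keys z - {s}. [:- t, 1:])"
  have "lin_ext (poly p) z = (\<Sum>i\<le>Polynomial.degree p. Polynomial.coeff p i * lin_ext (\<lambda>s. s ^ i) z)"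
    unfolding lin_ext_def poly_altdef sum_distrib_left
    by (subst sum.swap) (simp add: mult.left_commute)
  also have "\<dots> = 0" by (simp add: assms)
  finally have "0 = lin_ext (poly p) z" ..
  also have "\<dots> = (\<Sum>t\<in>Poly_Mapping.keys z. if s = t then Poly_Mapping.lookup z s * poly p s else 0)"
    unfolding lin_ext_def by (intro sum.cong) (auto simp: p_def poly_prod)
  also have "\<dots> = Poly_Mapping.lookup z s * poly p s"
    using s by simp
  finally show False
    using s by (auto simp: p_def poly_prod in_keys_iff)
qed

lemma finsum_restrict_scalars: "finsum (restrict_scalars \<iota> M) = finsum M"
  by (simp add: finsum_def finprod_def restrict_scalars_def fun_eq_iff)

definition power_sum :: "('c::field \<Rightarrow>\<^sub>0 'c) \<Rightarrow> int \<Rightarrow> 'c" where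
  "power_sum x n = lin_ext (\<lambda>s. s powi n) x"

text \<open>Nonnegative exponents suffice, which is what makes the map into sequences
  injective.\<close>

lemma power_sum_inject:
  assumes "\<And>n. power_sum x (int n) = power_sum y (int n)"
  shows "x = y"
proof -
  have "lin_ext (\<lambda>s. s ^ n) (x - y) = 0" for n
    using assms[of n] by (simp add: power_sum_def lin_ext_diff power_int_of_nat)
  then show ?thesis
    using lin_ext_powers_eq_0[of "x - y"] by simp
qed

lemma power_sum_sum_single:
  "power_sum (\<Sum>s\<in>T. Poly_Mapping.single (g s) (c s)) n = (\<Sum>s\<in>T. c s * g s powi n)"
  by (simp add: power_sum_def lin_ext_sum)

lemma power_sum_0: "power_sum 0 n = 0"
  and power_sum_single: "power_sum (Poly_Mapping.single s c) n = c * s powi n"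
  by (simp_all add: power_sum_def)

lemma power_sum_eq:
  "power_sum x n = (\<Sum>s\<in>Poly_Mapping.keys x. Poly_Mapping.lookup x s * s powi n)"
  by (simp add: power_sum_def lin_ext_def)

lemma keys_sum_single:
  "(\<And>s. s \<in> T \<Longrightarrow> g s \<in> S) \<Longrightarrow> Poly_Mapping.keys (\<Sum>s\<in>T. Poly_Mapping.single (g s) (c s)) \<subseteq> S"
  using keys_sum[of "\<lambda>s. Poly_Mapping.single (g s) (c s)" T] by (fastforce split: if_splits)

section \<open>The invariants as functions on the integers\<close>

locale galois_invariants = algebraic_embedding \<iota> for \<iota> :: "'k::field \<Rightarrow> 'c::alg_closed_field" +
  fixes S :: "'c set"
  assumes char_0: "CHAR('k) = 0"
    and zero_notin: "0 \<notin> S"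
    and one_in: "1 \<in> S"
    and mult_in: "\<lbrakk>x \<in> S; y \<in> S\<rbrakk> \<Longrightarrow> x * y \<in> S"
    and inverse_in: "x \<in> S \<Longrightarrow> inverse x \<in> S"
begin

abbreviation H where "H \<equiv> (units_of (scalars :: 'c ring))\<lparr>carrier := S\<rparr>"
abbreviation B where "B \<equiv> group_algebra_alg H :: ('c, 'c \<Rightarrow>\<^sub>0 'c) module"
abbreviation A where "A \<equiv> invariant_alg \<iota> S"

lemma carrier_B: "x \<in> carrier B \<longleftrightarrow> Poly_Mapping.keys x \<subseteq> S"
  by (simp add: group_algebra_alg_def)

lemma algebra_coordinates_B: "algebra_coordinates B power_sum"
proof
  fix x y n c assume xy: "x \<in> carrier B" "y \<in> carrier B"
  then have keys: "Poly_Mapping.keys x \<subseteq> S" "Poly_Mapping.keys y \<subseteq> S"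
    by (simp_all add: group_algebra_alg_def)
  show "x \<oplus>\<^bsub>B\<^esub> y \<in> carrier B"
    using keys keys_add[of x y] by (auto simp: group_algebra_alg_def)
  show "power_sum (x \<oplus>\<^bsub>B\<^esub> y) n = power_sum x n + power_sum y n"
    by (simp add: group_algebra_alg_def power_sum_def lin_ext_add)
  have mult: "x \<otimes>\<^bsub>B\<^esub> y = (\<Sum>p\<in>Poly_Mapping.keys x \<times> Poly_Mapping.keys y.
      Poly_Mapping.single (fst p * snd p) (Poly_Mapping.lookup x (fst p) * Poly_Mapping.lookup y (snd p)))"
    by (simp add: group_algebra_alg_def units_of_def sum.cartesian_product case_prod_beta)
  show "x \<otimes>\<^bsub>B\<^esub> y \<in> carrier B"
  proof -
    have "Poly_Mapping.keys (x \<otimes>\<^bsub>B\<^esub> y) \<subseteq> S"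
      unfolding mult using keys by (intro keys_sum_single) (auto intro!: mult_in)
    then show ?thesis by (simp only: carrier_B)
  qed
  show "power_sum (x \<otimes>\<^bsub>B\<^esub> y) n = power_sum x n * power_sum y n"
    unfolding mult power_sum_sum_single power_sum_eq[of x] power_sum_eq[of y]
    by (simp add: sum_product sum.cartesian_product case_prod_beta power_int_mult_distrib ac_simps)
next
  fix x n c assume x: "x \<in> carrier B"
  then show "c \<odot>\<^bsub>B\<^esub> x \<in> carrier B"
    using keys_scale_pm[of c x] by (auto simp: group_algebra_alg_def)
  show "power_sum (c \<odot>\<^bsub>B\<^esub> x) n = c * power_sum x n"
    by (simp add: group_algebra_alg_def power_sum_def lin_ext_scale)
qed (auto simp: group_algebra_alg_def units_of_def power_sum_0 power_sum_single one_in intro: power_sum_inject)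

sublocale B: algebra_coordinates B power_sum by (rule algebra_coordinates_B)
sublocale BB: tensor_algebra_coordinates B power_sum B power_sum ..
sublocale BBT: algebra_coordinates BB.TP "tensor_eval power_sum power_sum"
  by (rule BB.algebra_coordinates_tensor)

lemma power_sum_galois_act:
  assumes "\<sigma> \<in> galois_group \<iota>"
  shows "power_sum (galois_act \<sigma> x) n = \<sigma> (power_sum x n)"
proof -
  interpret \<sigma>: field_embedding \<sigma>
    using assms by unfold_locales (simp add: galois_group_def ring_iso_def)
  show ?thesis
    by (simp add: galois_act_def power_sum_sum_single) (simp add: power_sum_eq \<sigma>.emb_simps)
qed

text \<open>The actions on coefficients and on group elements combine so that \<sigma> is applied to
  each power sum. Since power sums determine x, invariance of x is invariance of all of
  them.\<close>

lemma invariant_iff: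
  "(\<forall>\<sigma>\<in>galois_group \<iota>. galois_act \<sigma> x = x) \<longleftrightarrow> (\<forall>n. power_sum x n \<in> range \<iota>)"
proof
  assume inv: "\<forall>\<sigma>\<in>galois_group \<iota>. galois_act \<sigma> x = x"
  show "\<forall>n. power_sum x n \<in> range \<iota>"
    using power_sum_galois_act[of _ x] inv by (intro allI fixed_field[OF char_0]) metis
next
  assume inv: "\<forall>n. power_sum x n \<in> range \<iota>"
  show "\<forall>\<sigma>\<in>galois_group \<iota>. galois_act \<sigma> x = x"
  proof (intro ballI power_sum_inject)
    fix \<sigma> n assume \<sigma>: "\<sigma> \<in> galois_group \<iota>"
    obtain k where "power_sum x (int n) = \<iota> k" using inv by blast
    then show "power_sum (galois_act \<sigma> x) (int n) = power_sum x (int n)"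
      using \<sigma> by (simp add: power_sum_galois_act) (simp add: galois_group_def)
  qed
qed

lemma sigma_algebra_eq:
  "sigma_algebra S = module.extend B (bialgebra.fields
       (\<lambda>x. tensor_class B B (\<Sum>s\<in>Poly_Mapping.keys x.
          Poly_Mapping.single (Poly_Mapping.single s 1, Poly_Mapping.single s 1)
            (Poly_Mapping.lookup x s)))
       (\<lambda>x. \<Sum>s\<in>Poly_Mapping.keys x. Poly_Mapping.lookup x s))"
  by (simp add: sigma_algebra_def group_algebra_def Let_def)

lemma carrier_A: "x \<in> carrier A \<longleftrightarrow> x \<in> carrier B \<and> (\<forall>n. power_sum x n \<in> range \<iota>)"
  by (simp add: invariant_alg_def sigma_algebra_eq restrict_scalars_def invariant_iff)

lemma A_simps:
  "x \<oplus>\<^bsub>A\<^esub> y = x \<oplus>\<^bsub>B\<^esub> y" "x \<otimes>\<^bsub>A\<^esub> y = x \<otimes>\<^bsub>B\<^esub> y" "\<one>\<^bsub>A\<^esub> = \<one>\<^bsub>B\<^esub>" "\<zero>\<^bsub>A\<^esub> = \<zero>\<^bsub>B\<^esub>"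
  "c \<odot>\<^bsub>A\<^esub> x = \<iota> c \<odot>\<^bsub>B\<^esub> x"
  by (simp_all add: invariant_alg_def sigma_algebra_eq restrict_scalars_def)

text \<open>The power sum pulled back to K; it is meaningful on invariants, where
  \<open>emb_invariant_eval\<close> provides the preimage.\<close>

definition invariant_eval :: "('c \<Rightarrow>\<^sub>0 'c) \<Rightarrow> int \<Rightarrow> 'k" where
  "invariant_eval x n = (THE k. \<iota> k = power_sum x n)"

lemma invariant_eval_eqI: "\<iota> k = power_sum x n \<Longrightarrow> invariant_eval x n = k"
  unfolding invariant_eval_def by (rule the_equality) (auto simp: emb_eq_iff[symmetric])

lemma emb_invariant_eval: "x \<in> carrier A \<Longrightarrow> \<iota> (invariant_eval x n) = power_sum x n"
  unfolding carrier_A using invariant_eval_eqI by (metis rangeE)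

lemma A_subset_B: "x \<in> carrier A \<Longrightarrow> x \<in> carrier B"
  by (simp add: carrier_A)

lemma algebra_coordinates_A: "algebra_coordinates A invariant_eval"
proof -
  note simps = A_simps A_subset_B B.closed B.one_closed B.mult_closed B.e_simps B.e_one B.e_mult
  show ?thesis
  proof
    fix x y n c assume x: "x \<in> carrier A" and y: "y \<in> carrier A"
    note xy = emb_invariant_eval[OF x, symmetric] emb_invariant_eval[OF y, symmetric]
    show "x \<oplus>\<^bsub>A\<^esub> y \<in> carrier A" "x \<otimes>\<^bsub>A\<^esub> y \<in> carrier A"
      using x y unfolding carrier_A[of "_ \<oplus>\<^bsub>A\<^esub> _"] carrier_A[of "_ \<otimes>\<^bsub>A\<^esub> _"]
      by (auto simp: simps xy emb_add[symmetric] emb_mult[symmetric])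
    show "invariant_eval (x \<oplus>\<^bsub>A\<^esub> y) n = invariant_eval x n + invariant_eval y n" "invariant_eval (x \<otimes>\<^bsub>A\<^esub> y) n = invariant_eval x n * invariant_eval y n"
      using x y by (auto intro!: invariant_eval_eqI simp: simps xy emb_simps)
  next
    fix x n c assume x: "x \<in> carrier A"
    show "c \<odot>\<^bsub>A\<^esub> x \<in> carrier A"
      using x unfolding carrier_A[of "_ \<odot>\<^bsub>A\<^esub> _"]
      by (auto simp: simps emb_invariant_eval[OF x, symmetric] emb_mult[symmetric])
    show "invariant_eval (c \<odot>\<^bsub>A\<^esub> x) n = c * invariant_eval x n"
      using x by (auto intro!: invariant_eval_eqI simp: simps emb_invariant_eval emb_simps)
  next
    fix x y assume xy: "x \<in> carrier A" "y \<in> carrier A" "\<And>i. invariant_eval x i = invariant_eval y i"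
    show "x = y"
      by (rule power_sum_inject) (metis xy emb_invariant_eval)
  next
    show "\<zero>\<^bsub>A\<^esub> \<in> carrier A"
      unfolding carrier_A by (auto simp: simps intro: range_eqI[of _ _ 0] simp: emb_zero)
    show "\<one>\<^bsub>A\<^esub> \<in> carrier A"
      unfolding carrier_A by (auto simp: simps intro: range_eqI[of _ _ 1] simp: emb_one)
    show "invariant_eval \<zero>\<^bsub>A\<^esub> n = 0" "invariant_eval \<one>\<^bsub>A\<^esub> n = 1" for n
      by (auto intro!: invariant_eval_eqI simp: simps emb_simps)
  qed
qed

sublocale A: algebra_coordinates A invariant_eval by (rule algebra_coordinates_A)
sublocale AA: tensor_algebra_coordinates A invariant_eval A invariant_eval ..

lemma keys_A: "x \<in> carrier A \<Longrightarrow> Poly_Mapping.keys x \<subseteq> S"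
  using A_subset_B by (simp add: group_algebra_alg_def)

text \<open>A modified formal sum whose power sums are those of x at other indices is again
  invariant, since these values still lie in K.\<close>

lemma sum_single_in_A:
  assumes x: "x \<in> carrier A" and "\<And>s. s \<in> Poly_Mapping.keys x \<Longrightarrow> g s \<in> S"
    and ps: "\<And>n. (\<Sum>s\<in>Poly_Mapping.keys x. c s * g s powi n) = power_sum x (\<phi> n)"
  shows "\<exists>y\<in>carrier A. \<forall>n. invariant_eval y n = invariant_eval x (\<phi> n)"
proof -
  let ?y = "\<Sum>s\<in>Poly_Mapping.keys x. Poly_Mapping.single (g s) (c s)"
  have ps': "power_sum ?y n = \<iota> (invariant_eval x (\<phi> n))" for n
    by (simp add: power_sum_sum_single ps emb_invariant_eval x)
  have "?y \<in> carrier A"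
    using keys_sum_single[of "Poly_Mapping.keys x" g S c] assms(2)
    by (auto simp: carrier_A ps' group_algebra_alg_def)
  then show ?thesis
    by (intro bexI[of _ ?y] allI invariant_eval_eqI) (simp_all add: ps')
qed

lemma powi_add_keys:
  "\<lbrakk>x \<in> carrier B; s \<in> Poly_Mapping.keys x\<rbrakk> \<Longrightarrow> s powi (i + j) = s powi i * s powi j"
  using zero_notin by (intro power_int_add) (auto simp: carrier_B)

text \<open>Multiplying the coefficient of s by s^j shifts the index. These elements are the rows
  and columns from which the comultiplication is assembled.\<close>

lemma ex_shift: "x \<in> carrier A \<Longrightarrow> \<exists>y\<in>carrier A. \<forall>i. invariant_eval y i = invariant_eval x (i + j)"
  by (rule sum_single_in_A[where g = "\<lambda>s. s" and c = "\<lambda>s. Poly_Mapping.lookup x s * s powi j"])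
     (use keys_A in \<open>auto simp: power_sum_eq powi_add_keys[OF A_subset_B] ac_simps intro!: sum.cong\<close>)

lemma ex_reflect: "x \<in> carrier A \<Longrightarrow> \<exists>y\<in>carrier A. \<forall>i. invariant_eval y i = invariant_eval x (- i)"
  by (rule sum_single_in_A[where g = inverse and c = "Poly_Mapping.lookup x"])
     (use keys_A inverse_in in \<open>auto simp: power_sum_eq power_int_minus power_int_inverse\<close>)

lemma comult_sigma:
  assumes "x \<in> carrier B"
  shows "comult (sigma_algebra S) x \<in> carrier BB.TP"
    and "tensor_eval power_sum power_sum (comult (sigma_algebra S) x) (i, j) = power_sum x (i + j)"
proof -
  have keys: "Poly_Mapping.keys x \<subseteq> S"
    using assms by (simp add: group_algebra_alg_def)
  then have single: "Poly_Mapping.single s 1 \<in> carrier B" if "s \<in> Poly_Mapping.keys x" for s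
    using that by (auto simp: group_algebra_alg_def)
  then show "comult (sigma_algebra S) x \<in> carrier BB.TP"
    unfolding sigma_algebra_eq bialgebra_extend_simps
    by (intro BB.class_in_TP BB.C_sum BB.single_in_C)
  have "tensor_eval power_sum power_sum (comult (sigma_algebra S) x) (i, j)
      = (\<Sum>s\<in>Poly_Mapping.keys x. Poly_Mapping.lookup x s * (s powi i * s powi j))"
    by (simp add: sigma_algebra_eq BB.eval_class lin_ext_sum BB.bil_def power_sum_def)
  also have "\<dots> = power_sum x (i + j)"
    unfolding power_sum_eq using assms by (intro sum.cong) (simp_all add: powi_add_keys)
  finally show "tensor_eval power_sum power_sum (comult (sigma_algebra S) x) (i, j) = power_sum x (i + j)" .
qed

text \<open>On evaluations the canonical map from the tensor square over K to the one over the
  closure is just \<iota>, so its injectivity is that of \<iota>.\<close>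

lemma base_change_tensor:
  assumes "\<tau> \<in> carrier AA.TP"
  defines "L \<equiv> tensor_lift (restrict_scalars \<iota> BB.TP) (pure_tensor B B) \<tau>"
  shows "L \<in> carrier BB.TP"
    and "tensor_eval power_sum power_sum L (i, j) = \<iota> (tensor_eval invariant_eval invariant_eval \<tau> (i, j))"
proof -
  have L: "L = (\<Oplus>\<^bsub>BB.TP\<^esub>p\<in>Poly_Mapping.keys (tensor_rep \<tau>).
      \<iota> (Poly_Mapping.lookup (tensor_rep \<tau>) p) \<odot>\<^bsub>BB.TP\<^esub> pure_tensor B B (fst p) (snd p))"
    unfolding L_def tensor_lift_def finsum_restrict_scalars by (simp add: restrict_scalars_def)
  have keys: "fst p \<in> carrier A" "snd p \<in> carrier A" if "p \<in> Poly_Mapping.keys (tensor_rep \<tau>)" for p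
    using AA.rep_in_C[OF assms(1)] that by auto
  then have pure: "pure_tensor B B (fst p) (snd p) \<in> carrier BB.TP"
    if "p \<in> Poly_Mapping.keys (tensor_rep \<tau>)" for p
    using that by (intro BB.pure_closed A_subset_B) auto
  show "L \<in> carrier BB.TP"
    unfolding L using pure by (intro BBT.finsum_closed_e BBT.closed) auto
  have "tensor_eval power_sum power_sum L (i, j) = (\<Sum>p\<in>Poly_Mapping.keys (tensor_rep \<tau>).
      tensor_eval power_sum power_sum
        (\<iota> (Poly_Mapping.lookup (tensor_rep \<tau>) p) \<odot>\<^bsub>BB.TP\<^esub> pure_tensor B B (fst p) (snd p)) (i, j))"
    unfolding L using pure by (intro BBT.finsum_closed_e BBT.closed) auto
  also have "\<dots> = (\<Sum>p\<in>Poly_Mapping.keys (tensor_rep \<tau>).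
      \<iota> (Poly_Mapping.lookup (tensor_rep \<tau>) p * (invariant_eval (fst p) i * invariant_eval (snd p) j)))"
    using pure keys by (intro sum.cong) (simp_all add: BBT.e_simps BB.eval_pure emb_mult emb_invariant_eval)
  also have "\<dots> = \<iota> (tensor_eval invariant_eval invariant_eval \<tau> (i, j))"
    by (simp add: tensor_eval_def lin_ext_def emb_sum)
  finally show "tensor_eval power_sum power_sum L (i, j) = \<iota> (tensor_eval invariant_eval invariant_eval \<tau> (i, j))" .
qed

lemma bialgebra_coordinates_invariant: "bialgebra_coordinates (invariant_bialgebra \<iota> S) invariant_eval"
  unfolding invariant_bialgebra_def Let_def
proof (rule bialgebra_coordinates_extend)
  show "algebra_coordinates A invariant_eval" by (rule algebra_coordinates_A)
next
  fix x assume x: "x \<in> carrier A"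
  have "counit (sigma_algebra S) x = power_sum x 0"
    by (simp add: sigma_algebra_eq power_sum_eq)
  then show "(THE c. \<iota> c = counit (sigma_algebra S) x) = invariant_eval x 0"
    by (simp add: invariant_eval_def)
  show "\<exists>\<tau>\<in>carrier AA.TP. \<forall>i j. tensor_eval invariant_eval invariant_eval \<tau> (i, j) = invariant_eval x (i + j)"
  \<comment> \<open>Over the closure the array is a sum of one product for each key of x.\<close>
  proof (rule AA.ex_tensor_of_finite_rank[where S = "Poly_Mapping.keys x" and \<iota> = \<iota>])
    show "field_embedding \<iota>" by unfold_locales
    show "\<iota> (invariant_eval x (i + j)) = (\<Sum>s\<in>Poly_Mapping.keys x. (Poly_Mapping.lookup x s * s powi i) * s powi j)" for i j
      using x by (simp add: emb_invariant_eval power_sum_eq powi_add_keys[OF A_subset_B] mult.assoc)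
    show "\<exists>v\<in>carrier A. \<forall>i. invariant_eval v i = invariant_eval x (i + j)" for j
      using x by (rule ex_shift)
    show "\<exists>w\<in>carrier A. \<forall>j. invariant_eval w j = invariant_eval x (i + j)" for i
      using ex_shift[OF x, of i] by (simp add: add.commute)
  qed simp
next
  fix x \<tau> assume x: "x \<in> carrier A" and \<tau>: "\<tau> \<in> carrier AA.TP"
  have BB: "tensor_product (sigma_algebra S) (sigma_algebra S) = BB.TP"
    "pure_tensor (sigma_algebra S) (sigma_algebra S) = pure_tensor B B"
    by (simp_all add: sigma_algebra_eq pure_tensor_def tensor_class_def tensor_relators_def fun_eq_iff)
  note c = comult_sigma[OF A_subset_B[OF x]] and b = base_change_tensor[OF \<tau>]
  let ?L = "tensor_lift (restrict_scalars \<iota> BB.TP) (pure_tensor B B) \<tau>"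
  have "?L = comult (sigma_algebra S) x \<longleftrightarrow> (\<forall>i j. tensor_eval power_sum power_sum ?L (i, j) =
      tensor_eval power_sum power_sum (comult (sigma_algebra S) x) (i, j))"
    using b(1) c(1) BB.tensor_eq_pairI by auto
  also have "\<dots> \<longleftrightarrow> (\<forall>i j. tensor_eval invariant_eval invariant_eval \<tau> (i, j) = invariant_eval x (i + j))"
    by (simp add: b(2) c(2) emb_invariant_eval[OF x, symmetric] emb_eq_iff)
  finally show "tensor_lift (restrict_scalars \<iota> (tensor_product (sigma_algebra S) (sigma_algebra S)))
      (pure_tensor (sigma_algebra S) (sigma_algebra S)) \<tau> = comult (sigma_algebra S) x \<longleftrightarrow>
      (\<forall>i j. tensor_eval invariant_eval invariant_eval \<tau> (i, j) = invariant_eval x (i + j))"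
    unfolding BB .
qed

lemma carrier_invariant_bialgebra: "carrier (invariant_bialgebra \<iota> S) = carrier A"
  by (simp add: invariant_bialgebra_def Let_def)

lemma hopf_algebra_invariant: "hopf_algebra (invariant_bialgebra \<iota> S)"
  using bialgebra_coordinates_invariant
  by (rule hopf_algebra_of_coordinates) (simp add: carrier_invariant_bialgebra ex_reflect)

text \<open>A representative of the comultiplication decomposes the Hankel array over K itself,
  whereas the keys of x do so only over the closure.\<close>

lemma invariant_eval_linear_recursive:
  assumes x: "x \<in> carrier A"
  shows "(\<lambda>n. invariant_eval x (int n)) \<in> linear_recursive"
proof -
  interpret I: bialgebra_coordinates "invariant_bialgebra \<iota> S" invariant_eval
    by (rule bialgebra_coordinates_invariant)
  let ?\<tau> = "tensor_rep (comult (invariant_bialgebra \<iota> S) x)"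
  have "invariant_eval x (int (i + j)) = (\<Sum>p\<in>Poly_Mapping.keys ?\<tau>.
      (Poly_Mapping.lookup ?\<tau> p * invariant_eval (fst p) (int i)) * invariant_eval (snd p) (int j))" for i j
    using x by (simp add: I.comult_eval[symmetric] carrier_invariant_bialgebra tensor_eval_def lin_ext_def mult.assoc)
  then show ?thesis
    by (intro linear_recursiveI) auto
qed

lemma ex_bialgebra_hom:
  "\<exists>h. bialgebra_hom (invariant_bialgebra \<iota> S) linrec_bialgebra h \<and>
     inj_on h (carrier (invariant_bialgebra \<iota> S))"
proof (intro exI conjI)
  let ?h = "\<lambda>x n. invariant_eval x (int n)"
  have carrier: "carrier (linrec_bialgebra :: ('k, nat \<Rightarrow> 'k) bialgebra) = linear_recursive"
    by (simp add: linrec_bialgebra_def) (simp add: linrec_alg_def)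
  show "bialgebra_hom (invariant_bialgebra \<iota> S) linrec_bialgebra ?h"
    \<comment> \<open>The index homomorphism is the inclusion of the naturals into the
      integers.\<close>
    by (rule bialgebra_hom_of_coordinates[OF bialgebra_coordinates_invariant bialgebra_coordinates_linrec, where \<phi> = int])
       (simp_all add: carrier carrier_invariant_bialgebra invariant_eval_linear_recursive)
  show "inj_on ?h (carrier (invariant_bialgebra \<iota> S))"
  proof (rule inj_onI, unfold carrier_invariant_bialgebra)
    fix x y assume xy: "x \<in> carrier A" "y \<in> carrier A" "?h x = ?h y"
    show "x = y"
    proof (rule power_sum_inject)
      fix n
      have "invariant_eval x (int n) = invariant_eval y (int n)" using xy(3) by meson
      then show "power_sum x (int n) = power_sum y (int n)"
        using emb_invariant_eval xy(1,2) by metis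
    qed
  qed
qed

end

theorem proposition4:
  fixes \<rho> :: "'r::idom \<Rightarrow> 'k::field"
    and \<iota> :: "'k \<Rightarrow> 'c::alg_closed_field"
    and \<Sigma> :: "'c set"
  assumes "fraction_field \<rho>"
    and "CHAR('k) = 0"
    and "algebraic_closure_emb \<iota>"
    and "cyclotomic_bost_connes_datum \<iota> \<Sigma>"
  shows "hopf_algebra (invariant_bialgebra \<iota> \<Sigma>) \<and>
    (\<exists>h. bialgebra_hom (invariant_bialgebra \<iota> \<Sigma>) linrec_bialgebra h \<and>
         inj_on h (carrier (invariant_bialgebra \<iota> \<Sigma>)))"
proof -
  let ?U = "units_of (scalars :: 'c ring)"
  interpret cring "scalars :: 'c ring" by (rule cring_from_type_algebra)
  interpret U: group ?U by (rule units_group)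
  interpret \<Sigma>: subgroup \<Sigma> ?U
    using assms(4) by (simp add: cyclotomic_bost_connes_datum_def)
  have units: "x \<noteq> 0" if "x \<in> \<Sigma>" for x
    using \<Sigma>.subset that by (auto simp: units_of_def Units_def)
  interpret galois_invariants \<iota> \<Sigma>
  proof
    show "\<iota> \<in> ring_hom scalars scalars" "\<exists>p. p \<noteq> 0 \<and> poly (map_poly \<iota> p) x = 0" for x
      using assms(3) by (auto simp: algebraic_closure_emb_def)
    show "CHAR('k) = 0" by fact
    show "0 \<notin> \<Sigma>" using units by blast
    show "1 \<in> \<Sigma>" using \<Sigma>.one_closed by (simp add: units_of_def)
    show "x * y \<in> \<Sigma>" if "x \<in> \<Sigma>" "y \<in> \<Sigma>" for x y
      using \<Sigma>.m_closed[OF that] by (simp add: units_of_def)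
    show "inverse x \<in> \<Sigma>" if x: "x \<in> \<Sigma>" for x
    proof -
      have "inv\<^bsub>?U\<^esub> x * x = 1"
        using U.l_inv[of x] x \<Sigma>.subset by (auto simp: units_of_def)
      then have "inverse x = inv\<^bsub>?U\<^esub> x"
        using units[OF x] by (simp add: field_simps)
      then show ?thesis using \<Sigma>.m_inv_closed[OF x] by simp
    qed
  qed
  show ?thesis
    using hopf_algebra_invariant ex_bialgebra_hom by blast
qed

end
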